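(* Let $\mu\in\mathcal{M}_2$ be a finite nonzero measure on $\mathbb{R}^n$. Then $\mu$ and its Fourier transform $\widehat\mu$ cannot both be supported in sets of finite Lebesgue measure; that is, there do not exist sets $E,F\subset\mathbb{R}^n$ of finite Lebesgue measure such that $\mu$ is supported in $F$ and $\widehat\mu$ is supported in $E$.
   Context: For functions, $\widehat f(y)=\int_{\mathbb{R}^n} f(x)e^{-2\pi i x\cdot y}\,dx$ (extended to $L^p(\mathbb{R}^n)$, in the distributional sense when necessary). $p'$ denotes the conjugate exponent, $\frac1p+\frac1{p'}=1$, and $\|\cdot\|_p$ the norm of $L^p(\mathbb{R}^n,dx)$. For $p\in[1,\infty]$, $\widehat L^p(\mathbb{R}^n)=\{f\in L^p(\mathbb{R}^n): f=\widehat g \text{ for some } g\in L^{p'}(\mathbb{R}^n)\}$ with norm $\|f\|_{\widehat L^p}=\|\widehat f\|_{p'}$. $\mathcal{M}$ is the space of sigma-finite Borel measures on $\mathbb{R}^n$ (not assumed positive or real-valued). For $\mu\in\mathcal{M}$, $\|\mu\|_p^*=\sup\left\{\left|\int_{\mathbb{R}^n}h\,d\mu\right| : h\in\widehat L^{p'}(\mathbb{R}^n),\ \|h\|_{\widehat L^{p'}}\le 1\right\}$, and $\mathcal{M}_p=\{\mu\in\mathcal{M}:\|\mu\|_p^*<\infty\}$. The Fourier transform of a finite Borel measure is the function $\widehat\mu(y)=\int_{\mathbb{R}^n}e^{-2\pi i x\cdot y}\,d\mu(x)$. A measure $\mu$ is supported in a set $E\subset\mathbb{R}^n$ if $\mu(G)=0$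 for every measurable set $G$ that does not intersect $E$; a function is supported in $E$ if it vanishes outside $E$. *)

theory Defs
  imports "HOL-Analysis.Analysis"
begin

section \<open>Square-integrable functions and their Fourier transform\<close>

text \<open>Functions are Borel representatives; identities between elements of \<open>L\<^sup>2\<close> are
  stated almost everywhere.\<close>

definition L2 :: "(real^'n \<Rightarrow> complex) set" where
  "L2 = {f \<in> borel_measurable borel. integrable lborel (\<lambda>x. (norm (f x))\<^sup>2)}"

definition L2_norm :: "(real^'n \<Rightarrow> complex) \<Rightarrow> real" where
  "L2_norm f = sqrt (LINT x|lborel. (norm (f x))\<^sup>2)"

definition fourier :: "(real^'n \<Rightarrow> complex) \<Rightarrow> real^'n \<Rightarrow> complex" where
  "fourier f y = (LINT x|lborel. f x * exp (- 2 * complex_of_real pi * \<i> * complex_of_real (x \<bullet> y)))"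

text \<open>The extension to \<open>L\<^sup>2\<close> by continuity from \<open>L\<^sup>1 \<inter> L\<^sup>2\<close>. It is determined only up to
  a null set, hence the choice operator.\<close>

definition L2_fourier :: "(real^'n \<Rightarrow> complex) \<Rightarrow> real^'n \<Rightarrow> complex" where
  "L2_fourier f = (SOME g. g \<in> L2 \<and>
     (\<exists>\<phi> :: nat \<Rightarrow> real^'n \<Rightarrow> complex.
        (\<forall>k. \<phi> k \<in> L2 \<and> integrable lborel (\<phi> k) \<and> fourier (\<phi> k) \<in> L2) \<and>
        (\<lambda>k. L2_norm (\<lambda>x. \<phi> k x - f x)) \<longlonglongrightarrow> 0 \<and>
        (\<lambda>k. L2_norm (\<lambda>y. fourier (\<phi> k) y - g y)) \<longlonglongrightarrow> 0))"

text \<open>The space \<open>\<hat>L\<^sup>p\<close> for the self-conjugate exponent \<open>p = p' = 2\<close>.\<close>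

definition hatL2 :: "(real^'n \<Rightarrow> complex) set" where
  "hatL2 = {f \<in> L2. \<exists>g \<in> L2. AE x in lborel. f x = L2_fourier g x}"

definition hatL2_norm :: "(real^'n \<Rightarrow> complex) \<Rightarrow> real" where
  "hatL2_norm f = L2_norm (L2_fourier f)"


section \<open>Sigma-finite complex Borel measures\<close>

text \<open>A sigma-finite complex measure need not have a value on sets of infinite variation
  (\<open>\<infinity> - \<infinity>\<close>), so it is a partial set function, whose domain consists of the Borel sets of finite
  total variation. The fourth clause says that the domain is not too small: a Borel set
  on whose measured subsets the values are bounded has finite variation and is measured.\<close>

definition sigma_finite_complex_measures :: "((real^'n) set \<rightharpoonup> complex) set" where
  "sigma_finite_complex_measures = {\<mu>.
     dom \<mu> \<subseteq> sets borel \<and>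
     (\<forall>A \<in> dom \<mu>. \<forall>B \<in> sets borel. B \<subseteq> A \<longrightarrow> B \<in> dom \<mu>) \<and>
     (\<forall>A \<in> dom \<mu>. \<forall>B \<in> dom \<mu>. A \<union> B \<in> dom \<mu>) \<and>
     (\<forall>A \<in> sets borel. bdd_above ((\<lambda>B. norm (the (\<mu> B))) ` {B \<in> dom \<mu>. B \<subseteq> A})
        \<longrightarrow> A \<in> dom \<mu>) \<and>
     (\<forall>A :: nat \<Rightarrow> (real^'n) set. range A \<subseteq> dom \<mu> \<longrightarrow> disjoint_family A \<longrightarrow>
        (\<Union>i. A i) \<in> dom \<mu> \<longrightarrow> (\<lambda>i. the (\<mu> (A i))) sums the (\<mu> (\<Union>i. A i))) \<and>
     (\<exists>A :: nat \<Rightarrow> (real^'n) set. range A \<subseteq> dom \<mu> \<and> (\<Union>i. A i) = UNIV)}"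

definition finite_cm :: "((real^'n) set \<rightharpoonup> complex) \<Rightarrow> bool" where
  "finite_cm \<mu> \<longleftrightarrow> UNIV \<in> dom \<mu>"

definition zero_cm :: "((real^'n) set \<rightharpoonup> complex) \<Rightarrow> bool" where
  "zero_cm \<mu> \<longleftrightarrow> (\<forall>A \<in> sets borel. \<mu> A = Some 0)"

definition supported_cm :: "((real^'n) set \<rightharpoonup> complex) \<Rightarrow> (real^'n) set \<Rightarrow> bool" where
  "supported_cm \<mu> E \<longleftrightarrow> (\<forall>G \<in> sets borel. G \<inter> E = {} \<longrightarrow> \<mu> G = Some 0)"

lemma finite_cm_iff:
  "\<mu> \<in> sigma_finite_complex_measures \<and> finite_cm \<mu> \<longleftrightarrow>
     dom \<mu> = sets borel \<and>
     (\<forall>A :: nat \<Rightarrow> (real^'n) set. range A \<subseteq> sets borel \<longrightarrow> disjoint_family A \<longrightarrow>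
        (\<lambda>i. the (\<mu> (A i))) sums the (\<mu> (\<Union>i. A i)))" (is "?L \<longleftrightarrow> ?R")
proof
  assume L: ?L
  then have S: "\<mu> \<in> sigma_finite_complex_measures" and U: "UNIV \<in> dom \<mu>"
    unfolding finite_cm_def by (rule conjunct1, rule conjunct2)
  note S' = S[unfolded sigma_finite_complex_measures_def mem_Collect_eq]
  from S' have 1: "dom \<mu> \<subseteq> sets borel" by (elim conjE)
  from S' have 2: "\<forall>A \<in> dom \<mu>. \<forall>B \<in> sets borel. B \<subseteq> A \<longrightarrow> B \<in> dom \<mu>" by (elim conjE)
  from S' have 3: "\<forall>A :: nat \<Rightarrow> (real^'n) set. range A \<subseteq> dom \<mu> \<longrightarrow> disjoint_family A \<longrightarrow>
        (\<Union>i. A i) \<in> dom \<mu> \<longrightarrow> (\<lambda>i. the (\<mu> (A i))) sums the (\<mu> (\<Union>i. A i))" by (elim conjE)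
  have d: "dom \<mu> = sets borel"
  proof (rule subset_antisym[OF 1], rule subsetI)
    fix B :: "(real^'n) set" assume "B \<in> sets borel"
    from 2[rule_format, OF U this subset_UNIV] show "B \<in> dom \<mu>" .
  qed
  show ?R
  proof (intro conjI allI impI)
    show "dom \<mu> = sets borel" by (rule d)
    fix A :: "nat \<Rightarrow> (real^'n) set"
    assume A: "range A \<subseteq> sets borel" "disjoint_family A"
    have "(\<Union>i. A i) \<in> sets borel" using A(1) by (rule sets.countable_UN)
    from 3[rule_format, unfolded d, OF A this]
    show "(\<lambda>i. the (\<mu> (A i))) sums the (\<mu> (\<Union>i. A i))" .
  qed
next
  assume R: ?R
  then have d: "dom \<mu> = sets borel" by (elim conjE)
  from R have 3: "\<forall>A :: nat \<Rightarrow> (real^'n) set. range A \<subseteq> sets borel \<longrightarrow> disjoint_family A \<longrightarrow>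
        (\<lambda>i. the (\<mu> (A i))) sums the (\<mu> (\<Union>i. A i))" by (elim conjE)
  show ?L
    unfolding sigma_finite_complex_measures_def finite_cm_def mem_Collect_eq d
  proof (intro conjI)
    show "\<exists>A :: nat \<Rightarrow> (real^'n) set. range A \<subseteq> sets borel \<and> (\<Union>i. A i) = UNIV"
      by (rule exI[of _ "\<lambda>_. UNIV"]) simp
    show "\<forall>A :: nat \<Rightarrow> (real^'n) set. range A \<subseteq> sets borel \<longrightarrow> disjoint_family A \<longrightarrow>
        (\<Union>i. A i) \<in> sets borel \<longrightarrow> (\<lambda>i. the (\<mu> (A i))) sums the (\<mu> (\<Union>i. A i))"
      using 3 by simp
  qed simp_all
qed

text \<open>For \<open>c = 1, -1, -\<i>, \<i>\<close> this is the positive and the negative part of \<open>Re \<mu>\<close> and the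
  positive and the negative part of \<open>Im \<mu>\<close> in the Jordan decomposition; negative values of the real part
  are cut off by \<^const>\<open>ennreal\<close>.\<close>

definition jordan_part :: "complex \<Rightarrow> ((real^'n) set \<rightharpoonup> complex) \<Rightarrow> (real^'n) measure" where
  "jordan_part c \<mu> = measure_of UNIV (sets borel)
     (\<lambda>A. SUP B \<in> {B \<in> dom \<mu>. B \<subseteq> A}. ennreal (Re (c * the (\<mu> B))))"

lemma sets_jordan_part [simp]: "sets (jordan_part c \<mu>) = sets borel"
  and space_jordan_part [simp]: "space (jordan_part c \<mu>) = UNIV"
  using sets.sigma_sets_eq[of borel] by (simp_all add: jordan_part_def)

lemma emeasure_jordan_part:
  fixes \<mu> :: "(real^'n) set \<rightharpoonup> complex"
  assumes \<mu>: "\<mu> \<in> sigma_finite_complex_measures" and A: "A \<in> sets borel"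
  shows "emeasure (jordan_part c \<mu>) A =
    (SUP B \<in> {B \<in> dom \<mu>. B \<subseteq> A}. ennreal (Re (c * the (\<mu> B))))"
proof -
  define g where "g B = ennreal (Re (c * the (\<mu> B)))" for B
  define f where "f A = (SUP B \<in> {B \<in> dom \<mu>. B \<subseteq> A}. g B)" for A
  note \<mu>' = \<mu>[unfolded sigma_finite_complex_measures_def mem_Collect_eq]
  from \<mu>' have sub: "dom \<mu> \<subseteq> sets borel" by (elim conjE)
  from \<mu>' have "\<forall>A \<in> dom \<mu>. \<forall>B \<in> sets borel. B \<subseteq> A \<longrightarrow> B \<in> dom \<mu>" by (elim conjE)
  then have her: "B \<in> dom \<mu>" if "A \<in> dom \<mu>" "B \<in> sets borel" "B \<subseteq> A" for A B
    using that by blast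
  from \<mu>' have "\<forall>A \<in> dom \<mu>. \<forall>B \<in> dom \<mu>. A \<union> B \<in> dom \<mu>" by (elim conjE)
  then have un: "A \<union> B \<in> dom \<mu>" if "A \<in> dom \<mu>" "B \<in> dom \<mu>" for A B
    using that by blast
  from \<mu>' have add0: "\<forall>A :: nat \<Rightarrow> (real^'n) set. range A \<subseteq> dom \<mu> \<longrightarrow> disjoint_family A \<longrightarrow>
        (\<Union>i. A i) \<in> dom \<mu> \<longrightarrow> (\<lambda>i. the (\<mu> (A i))) sums the (\<mu> (\<Union>i. A i))" by (elim conjE)
  have add: "(\<lambda>i. the (\<mu> (A i))) sums the (\<mu> (\<Union>i. A i))"
    if "range A \<subseteq> dom \<mu>" "disjoint_family A" "(\<Union>i. A i) \<in> dom \<mu>"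
    for A :: "nat \<Rightarrow> (real^'n) set"
    by (rule add0[rule_format, OF that])
  from \<mu>' have "\<exists>A :: nat \<Rightarrow> (real^'n) set. range A \<subseteq> dom \<mu> \<and> (\<Union>i. A i) = UNIV"
    by (elim conjE)
  then have ne: "\<exists>A. A \<in> dom \<mu>" by (meson range_subsetD)
  have emp: "{} \<in> dom \<mu>" using ne her by blast
  have emp0: "the (\<mu> {}) = 0"
  proof -
    have "(\<lambda>i::nat. the (\<mu> {})) sums the (\<mu> (\<Union>i::nat. {}))"
      by (rule add) (use emp in \<open>auto simp: disjoint_family_on_def\<close>)
    then have "(\<lambda>i::nat. the (\<mu> {})) \<longlonglongrightarrow> 0" by (intro summable_LIMSEQ_zero sums_summable)
    then show ?thesis by (simp add: LIMSEQ_const_iff)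
  qed
  have fadd: "the (\<mu> (B \<union> B')) = the (\<mu> B) + the (\<mu> B')"
    if "B \<in> dom \<mu>" "B' \<in> dom \<mu>" "B \<inter> B' = {}" for B B'
  proof -
    have u: "(\<Union>i. binaryset B B' i) = B \<union> B'" by (simp add: UN_binaryset_eq)
    have "(\<lambda>i. the (\<mu> (binaryset B B' i))) sums the (\<mu> (\<Union>i. binaryset B B' i))"
    proof (rule add)
      show "range (binaryset B B') \<subseteq> dom \<mu>"
        using that emp unfolding range_binaryset_eq by blast
      show "disjoint_family (binaryset B B')"
        using that by (auto simp: disjoint_family_on_def binaryset_def)
      show "(\<Union>i. binaryset B B' i) \<in> dom \<mu>" unfolding u by (intro un that)
    qed
    moreover have "(\<lambda>i. the (\<mu> (binaryset B B' i))) sums (the (\<mu> B) + the (\<mu> B'))"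
      using binaryset_sums[of "\<lambda>A. the (\<mu> A)" B B'] emp0 by simp
    ultimately show ?thesis unfolding u by (rule sums_unique2)
  qed
  have super: "f S + f T \<le> f (S \<union> T)" if "S \<inter> T = {}" for S T
  proof -
    have neS: "{B \<in> dom \<mu>. B \<subseteq> X} \<noteq> {}" for X using emp by blast
    have "g B + g B' \<le> f (S \<union> T)" if "B \<in> dom \<mu>" "B' \<in> dom \<mu>" "B \<subseteq> S" "B' \<subseteq> T" for B B'
    proof -
      have le: "X \<in> dom \<mu> \<Longrightarrow> X \<subseteq> S \<union> T \<Longrightarrow> g X \<le> f (S \<union> T)" for X
        unfolding f_def by (rule SUP_upper) blast
      consider "Re (c * the (\<mu> B)) < 0" | "Re (c * the (\<mu> B')) < 0"
        | "Re (c * the (\<mu> B)) \<ge> 0" "Re (c * the (\<mu> B')) \<ge> 0" by linarith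
      then show ?thesis
      proof cases
        case 1
        then have "g B = 0" by (simp add: g_def ennreal_neg)
        then show ?thesis using le[of B'] that by auto
      next
        case 2
        then have "g B' = 0" by (simp add: g_def ennreal_neg)
        then show ?thesis using le[of B] that by auto
      next
        case 3
        have "B \<inter> B' = {}" using that \<open>S \<inter> T = {}\<close> by blast
        then have "g B + g B' = g (B \<union> B')"
          using 3 fadd[of B B'] that
          by (simp add: g_def ennreal_plus[symmetric] distrib_left del: ennreal_plus)
        also have "\<dots> \<le> f (S \<union> T)" using le un that by blast
        finally show ?thesis .
      qed
    qed
    note pair = this
    have "g B + f T \<le> f (S \<union> T)" if "B \<in> dom \<mu>" "B \<subseteq> S" for B
      unfolding f_def[of T] ennreal_SUP_add_right[OF neS]
    proof (rule SUP_least)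
      fix B' assume "B' \<in> {B \<in> dom \<mu>. B \<subseteq> T}"
      then have "B' \<in> dom \<mu>" "B' \<subseteq> T" by (simp_all del: domIff)
      with that show "g B + g B' \<le> f (S \<union> T)" by (intro pair)
    qed
    note pair' = this
    show ?thesis
      unfolding f_def[of S] ennreal_SUP_add_left[OF neS, symmetric]
    proof (rule SUP_least)
      fix B assume "B \<in> {B \<in> dom \<mu>. B \<subseteq> S}"
      then have "B \<in> dom \<mu>" "B \<subseteq> S" by (simp_all del: domIff)
      then show "g B + f T \<le> f (S \<union> T)" by (rule pair')
    qed
  qed
  have mono: "f S \<le> f T" if "S \<subseteq> T" for S T
    unfolding f_def using that by (intro SUP_subset_mono) auto
  have f0: "f {} = 0"
  proof -
    have "{B \<in> dom \<mu>. B \<subseteq> {}} = {{}}" using emp by blast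
    then show ?thesis by (simp add: f_def g_def emp0)
  qed
  have ca: "countably_additive (sets borel) f"
  proof (rule countably_additiveI)
    fix X :: "nat \<Rightarrow> (real^'n) set"
    assume X: "range X \<subseteq> sets borel" "disjoint_family X"
    show "(\<Sum>i. f (X i)) = f (\<Union>i. X i)"
    proof (rule antisym)
      have part: "(\<Sum>i<n. f (X i)) \<le> f (\<Union>i<n. X i)" for n
      proof (induction n)
        case 0 then show ?case by (simp add: f0)
      next
        case (Suc n)
        have "X n \<inter> (\<Union>i<n. X i) = {}"
          unfolding Int_UN_distrib
        proof (rule SUP_bot_conv(1)[THEN iffD2], rule ballI)
          fix i assume "i \<in> {..<n}"
          then show "X n \<inter> X i = {}"
            using X(2) by (auto simp: disjoint_family_on_def)
        qed
        then have "f (X n) + f (\<Union>i<n. X i) \<le> f (X n \<union> (\<Union>i<n. X i))" by (rule super)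
        moreover have "X n \<union> (\<Union>i<n. X i) = (\<Union>i<Suc n. X i)"
          by (auto simp: less_Suc_eq)
        ultimately have "f (X n) + f (\<Union>i<n. X i) \<le> f (\<Union>i<Suc n. X i)" by simp
        with add_left_mono[OF Suc.IH, of "f (X n)"]
        have "f (X n) + (\<Sum>i<n. f (X i)) \<le> f (\<Union>i<Suc n. X i)" by (rule order_trans)
        then show ?case by (simp only: sum.lessThan_Suc add.commute)
      qed
      have "(\<Sum>i<n. f (X i)) \<le> f (\<Union>i. X i)" for n
        by (rule order_trans[OF part mono]) auto
      then show "(\<Sum>i. f (X i)) \<le> f (\<Union>i. X i)"
        by (simp add: suminf_eq_SUP SUP_least)
    next
      show "f (\<Union>i. X i) \<le> (\<Sum>i. f (X i))"
        unfolding f_def[of "\<Union>i. X i"]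
      proof (rule SUP_least)
        fix B assume B: "B \<in> {B \<in> dom \<mu>. B \<subseteq> (\<Union>i. X i)}"
        then have Bd: "B \<in> dom \<mu>" and Bs: "B \<subseteq> (\<Union>i. X i)" by (simp_all del: domIff)
        have eq: "(\<Union>i. B \<inter> X i) = B" using Bs by (simp add: Int_UN_distrib[symmetric] Int_absorb2)
        have d: "B \<inter> X i \<in> dom \<mu>" for i
        proof (rule her[OF Bd])
          show "B \<inter> X i \<in> sets borel"
            using subsetD[OF sub Bd] X(1) by (intro sets.Int) (simp_all add: range_subsetD)
        qed simp
        have "(\<lambda>i. the (\<mu> (B \<inter> X i))) sums the (\<mu> (\<Union>i. B \<inter> X i))"
        proof (rule add)
          show "range (\<lambda>i. B \<inter> X i) \<subseteq> dom \<mu>" by (rule image_subsetI) (rule d)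
          show "disjoint_family (\<lambda>i. B \<inter> X i)"
            using X(2) by (auto simp: disjoint_family_on_def)
          show "(\<Union>i. B \<inter> X i) \<in> dom \<mu>" using Bd eq by simp
        qed
        then have "(\<lambda>i. Re (c * the (\<mu> (B \<inter> X i)))) sums Re (c * the (\<mu> B))"
          unfolding eq by (intro sums_Re sums_mult)
        then have "(\<lambda>n. ennreal (\<Sum>i<n. Re (c * the (\<mu> (B \<inter> X i))))) \<longlonglongrightarrow> g B"
          unfolding sums_def g_def by (rule tendsto_ennrealI)
        moreover have "ennreal (\<Sum>i<n. Re (c * the (\<mu> (B \<inter> X i)))) \<le> (\<Sum>i. f (X i))" for n
        proof -
          have "ennreal (\<Sum>i<n. Re (c * the (\<mu> (B \<inter> X i))))
              \<le> ennreal (\<Sum>i<n. max 0 (Re (c * the (\<mu> (B \<inter> X i)))))"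
            by (intro ennreal_leI sum_mono) simp
          also have "\<dots> = (\<Sum>i<n. ennreal (max 0 (Re (c * the (\<mu> (B \<inter> X i))))))"
            by (rule sum_ennreal[symmetric]) simp
          also have "\<dots> = (\<Sum>i<n. g (B \<inter> X i))"
            by (intro sum.cong refl) (simp add: g_def max_def ennreal_neg)
          also have "\<dots> \<le> (\<Sum>i<n. f (X i))"
            unfolding f_def by (intro sum_mono SUP_upper) (simp add: d del: domIff)
          also have "\<dots> \<le> (\<Sum>i. f (X i))" by (rule sum_le_suminf) auto
          finally show ?thesis .
        qed
        ultimately show "g B \<le> (\<Sum>i. f (X i))"
          by (intro LIMSEQ_le_const2) auto
      qed
    qed
  qed
  have eq: "jordan_part c \<mu> = measure_of UNIV (sets borel) f"
    by (simp add: jordan_part_def f_def[abs_def] g_def)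
  have "emeasure (jordan_part c \<mu>) A = f A"
  proof (rule emeasure_measure_of[OF eq])
    show "positive (sets (jordan_part c \<mu>)) f" by (simp add: positive_def f0)
    show "countably_additive (sets (jordan_part c \<mu>)) f" using ca by simp
  qed (use A in auto)
  then show ?thesis by (simp add: f_def g_def)
qed

definition integrable_cm :: "((real^'n) set \<rightharpoonup> complex) \<Rightarrow> (real^'n \<Rightarrow> complex) \<Rightarrow> bool" where
  "integrable_cm \<mu> h \<longleftrightarrow> (\<forall>c \<in> {1, - 1, - \<i>, \<i>}. integrable (jordan_part c \<mu>) h)"

definition integral_cm :: "((real^'n) set \<rightharpoonup> complex) \<Rightarrow> (real^'n \<Rightarrow> complex) \<Rightarrow> complex" where
  "integral_cm \<mu> h =
     ((LINT x|jordan_part 1 \<mu>. h x) - (LINT x|jordan_part (- 1) \<mu>. h x)) +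
     \<i> * ((LINT x|jordan_part (- \<i>) \<mu>. h x) - (LINT x|jordan_part \<i> \<mu>. h x))"

definition fourier_cm :: "((real^'n) set \<rightharpoonup> complex) \<Rightarrow> real^'n \<Rightarrow> complex" where
  "fourier_cm \<mu> y = integral_cm \<mu> (\<lambda>x. exp (- 2 * complex_of_real pi * \<i> * complex_of_real (x \<bullet> y)))"


section \<open>The dual norm and the space \<open>M\<^sub>2\<close>\<close>

text \<open>\<open>h\<close> ranges over all Borel representatives of elements of the unit ball for which the integral
  is defined; Bochner integrals of the others would be the default value 0.\<close>

definition dual_norm2 :: "((real^'n) set \<rightharpoonup> complex) \<Rightarrow> ennreal" where
  "dual_norm2 \<mu> = (SUP h \<in> {h \<in> hatL2. hatL2_norm h \<le> 1 \<and> integrable_cm \<mu> h}.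
     ennreal (norm (integral_cm \<mu> h)))"

definition M2 :: "((real^'n) set \<rightharpoonup> complex) set" where
  "M2 = {\<mu> \<in> sigma_finite_complex_measures. dual_norm2 \<mu> < \<infinity>}"

end

theory Submission
  imports Defs "HOL-Complex_Analysis.Complex_Analysis"
begin

text \<open>Benedicks' argument, carried out for measures. After rescaling, \<open>F\<close> has measure less than 1.
  For every \<open>y\<close> the measure \<open>exp (- 2 \<pi> i x \<bullet> y) d\<mu>(x)\<close>, folded onto the torus, has the Fourier
  coefficients \<open>\<hat>\<mu> (y + m)\<close>, and for almost every \<open>y\<close> only finitely many \<open>y + m\<close> lie in
  \<open>E\<close>. By uniqueness of Fourier coefficients (Stone--Weierstrass) the folded measure is then a trigonometric
  polynomial; since it is supported in the image of \<open>F\<close>, it vanishes on a set of positive measure, hence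
  identically. So \<open>\<hat>\<mu>\<close> vanishes almost everywhere, by continuity everywhere, and \<open>\<mu>\<close> is zero.\<close>

section \<open>Characters and uniqueness on the torus\<close>

text \<open>For an integrable function the periodization can be evaluated at points, which a measure
  does not allow. So the folded measure is never formed: it is present only as the functional
  sending \<open>f\<close> to \<open>LINT s|M. f (torus_map (X s)) * u s\<close>, and being a
  trigonometric polynomial means agreeing with the functional that this polynomial defines over the
  unit cube. The uniqueness lemmas therefore compare two measure spaces \<open>M\<close> and
  \<open>N\<close>, each with a map and a complex weight.

  The threshold 1 is the volume of the unit cube: a set of smaller measure cannot meet almost every
  coset of the integer lattice, so a part of the cube of positive measure carries nothing of the
  folded measure. In several variables a nonzero trigonometric polynomial may have uncountably many
  zeros; the contradiction comes from the zero set being Lebesgue null.\<close>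

definition character :: "real^'n \<Rightarrow> real^'n \<Rightarrow> complex" where
  "character k x = cis (2 * pi * (k \<bullet> x))"

definition int_vec :: "int^'n \<Rightarrow> real^'n" where
  "int_vec m = (\<chi> i. of_int (m $ i))"

text \<open>Placing the torus in a Euclidean space makes polynomial approximation on compact sets
  available: real polynomials in the coordinates pull back to trigonometric polynomials.\<close>

definition torus_map :: "real^'n \<Rightarrow> complex^'n" where
  "torus_map x = (\<chi> i. cis (2 * pi * x $ i))"

lemma norm_character [simp]: "norm (character k x) = 1"
  by (simp add: character_def)

lemma character_add_left: "character (k + l) x = character k x * character l x"
  by (simp add: character_def cis_mult inner_add_left distrib_left)

lemma character_add_right: "character k (x + y) = character k x * character k y"
  by (simp add: character_def cis_mult inner_add_right distrib_left)

lemma character_0_left [simp]: "character 0 x = 1"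
  by (simp add: character_def)

lemma continuous_on_character [continuous_intros]:
  assumes "continuous_on S f" "continuous_on S g"
  shows "continuous_on S (\<lambda>x. character (f x) (g x))"
  unfolding character_def cis_conv_exp by (intro continuous_intros assms)

lemma borel_measurable_character [measurable]:
  assumes [measurable]: "f \<in> borel_measurable M" "g \<in> borel_measurable M"
  shows "(\<lambda>x. character (f x) (g x)) \<in> borel_measurable M"
  unfolding character_def cis_conv_exp by measurable

lemma continuous_on_torus_map [continuous_intros]:
  assumes "continuous_on S f"
  shows "continuous_on S (\<lambda>x. torus_map (f x))"
  unfolding torus_map_def cis_conv_exp by (intro continuous_intros assms)

lemma borel_measurable_torus_map [measurable]: "torus_map \<in> borel_measurable borel"
  by (intro borel_measurable_continuous_onI continuous_on_torus_map continuous_on_id)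

lemma int_vec_add: "int_vec (a + b) = int_vec a + int_vec b"
  by (simp add: int_vec_def vec_eq_iff)

lemma int_vec_minus: "int_vec (- a) = - int_vec a"
  by (simp add: int_vec_def vec_eq_iff)

lemma int_vec_0 [simp]: "int_vec 0 = 0"
  by (simp add: int_vec_def vec_eq_iff)

lemma bounded_integrable_mult:
  fixes f u :: "'a \<Rightarrow> complex"
  assumes [measurable]: "f \<in> borel_measurable M" and u: "integrable M u"
    and B: "\<And>x. norm (f x) \<le> B"
  shows "integrable M (\<lambda>x. f x * u x)"
proof (rule Bochner_Integration.integrable_bound)
  show "integrable M (\<lambda>x. B * norm (u x))" using u by simp
  show "(\<lambda>x. f x * u x) \<in> borel_measurable M"
    using u by measurable
  show "AE x in M. norm (f x * u x) \<le> norm (B * norm (u x))"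
  proof (rule AE_I2)
    fix x
    have "0 \<le> B" using B[of x] norm_ge_zero order_trans by blast
    then show "norm (f x * u x) \<le> norm (B * norm (u x))"
      using mult_right_mono[OF B[of x], of "norm (u x)"] by (simp add: norm_mult)
  qed
qed

text \<open>Real polynomials composed with \<open>torus_map\<close> are combinations of integer
  characters, so both sides agree on them; they approximate \<open>g\<close> uniformly on a ball
  containing the torus, and the two integrals are continuous for uniform convergence because the
  weights are integrable.\<close>

lemma torus_continuous_unique:
  fixes X :: "'a \<Rightarrow> real^'n" and Y :: "'b \<Rightarrow> real^'n"
    and u :: "'a \<Rightarrow> complex" and v :: "'b \<Rightarrow> complex" and g :: "complex^'n \<Rightarrow> real"
  assumes X [measurable]: "X \<in> borel_measurable M" and Y [measurable]: "Y \<in> borel_measurable N"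
    and u: "integrable M u" and v: "integrable N v"
    and eq: "\<And>m. (LINT s|M. character (int_vec m) (X s) * u s)
                = (LINT s|N. character (int_vec m) (Y s) * v s)"
    and g: "continuous_on UNIV g"
  shows "(LINT s|M. of_real (g (torus_map (X s))) * u s)
       = (LINT s|N. of_real (g (torus_map (Y s))) * v s)"
proof -
  define D where "D f = (LINT s|M. f (X s) * u s) - (LINT s|N. f (Y s) * v s)" for f
  define bb where "bb f \<longleftrightarrow> f \<in> borel_measurable borel \<and> (\<exists>B. \<forall>x. norm (f x) \<le> B)"
    for f :: "real^'n \<Rightarrow> complex"
  have bb_int: "integrable M (\<lambda>s. f (X s) * u s)" "integrable N (\<lambda>s. f (Y s) * v s)" if f: "bb f" for f
  proof -
    from f obtain B where [measurable]: "f \<in> borel_measurable borel" and B: "\<And>x. norm (f x) \<le> B"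
      by (auto simp: bb_def)
    show "integrable M (\<lambda>s. f (X s) * u s)" by (rule bounded_integrable_mult[OF _ u B]) measurable
    show "integrable N (\<lambda>s. f (Y s) * v s)" by (rule bounded_integrable_mult[OF _ v B]) measurable
  qed
  have bb_add: "bb (\<lambda>x. f x + h x)" if f: "bb f" and h: "bb h" for f h
  proof -
    from f obtain B where B: "f \<in> borel_measurable borel" "\<And>x. norm (f x) \<le> B" by (auto simp: bb_def)
    from h obtain C where C: "h \<in> borel_measurable borel" "\<And>x. norm (h x) \<le> C" by (auto simp: bb_def)
    show ?thesis unfolding bb_def
      using B C by (auto intro!: exI[of _ "B + C"] norm_triangle_le add_mono)
  qed
  have bb_mult: "bb (\<lambda>x. f x * h x)" if f: "bb f" and h: "bb h" for f h
  proof -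
    from f obtain B where B: "f \<in> borel_measurable borel" "\<And>x. norm (f x) \<le> B" by (auto simp: bb_def)
    from h obtain C where C: "h \<in> borel_measurable borel" "\<And>x. norm (h x) \<le> C" by (auto simp: bb_def)
    have "0 \<le> B" using B(2)[of 0] norm_ge_zero order_trans by blast
    then show ?thesis unfolding bb_def
      using B C by (auto intro!: exI[of _ "B * C"] mult_mono simp: norm_mult)
  qed
  have bb_const: "bb (\<lambda>x. c)" for c by (auto simp: bb_def)
  have bb_char: "bb (character k)" for k
    by (auto simp: bb_def intro!: exI[of _ 1])
  have D_add: "D (\<lambda>x. f x + h x) = D f + D h" if "bb f" "bb h" for f h
    using bb_int[OF that(1)] bb_int[OF that(2)]
    by (simp add: D_def distrib_right)
  have D_scale: "D (\<lambda>x. c * f x) = c * D f" for f c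
    by (simp add: D_def mult.assoc right_diff_distrib)
  \<comment> \<open>The kernel of \<open>D\<close> need not be closed under products.
    \<open>V\<close> asks for vanishing against every integer character, so that characters map it
    to itself; the multipliers of \<open>V\<close> collected in \<open>A\<close> are then closed
    under products by associativity.\<close>
  define V where "V = {h. bb h \<and> (\<forall>m. D (\<lambda>x. character (int_vec m) x * h x) = 0)}"
  define A where "A = {p. bb p \<and> (\<forall>h\<in>V. (\<lambda>x. p x * h x) \<in> V)}"
  have A_add: "(\<lambda>x. p x + q x) \<in> A" if "p \<in> A" "q \<in> A" for p q
    unfolding A_def mem_Collect_eq
  proof (intro conjI ballI)
    show "bb (\<lambda>x. p x + q x)" using that by (auto simp: A_def intro!: bb_add)
    fix h assume "h \<in> V"
    then have "(\<lambda>x. p x * h x) \<in> V" "(\<lambda>x. q x * h x) \<in> V" using that by (auto simp: A_def)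
    then show "(\<lambda>x. (p x + q x) * h x) \<in> V"
      unfolding V_def by (simp add: distrib_left distrib_right bb_add D_add bb_mult bb_char)
  qed
  have A_mult: "(\<lambda>x. p x * q x) \<in> A" if "p \<in> A" "q \<in> A" for p q
    using that by (auto simp: A_def bb_mult mult.assoc)
  have A_const: "(\<lambda>x. c) \<in> A" for c
    unfolding A_def V_def using D_scale by (auto simp: bb_const bb_mult mult.left_commute)
  have A_char: "character (int_vec k) \<in> A" for k
  proof -
    have e: "character (int_vec m) x * (character (int_vec k) x * h x)
        = character (int_vec (m + k)) x * h x" for m x and h :: "_ \<Rightarrow> complex"
      by (simp add: int_vec_add character_add_left)
    then have "D (\<lambda>x. character (int_vec m) x * (character (int_vec k) x * h x)) = 0" if "h \<in> V" for m h
      using that unfolding e V_def by blast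
    then show ?thesis unfolding A_def V_def by (auto simp: bb_mult bb_char)
  qed
  have A_sum: "(\<lambda>x. \<Sum>i\<in>I. p i x) \<in> A" if "finite I" "\<And>i. i \<in> I \<Longrightarrow> p i \<in> A" for I :: "'n set" and p
    using that by (induction I rule: finite_induct) (auto simp: A_const A_add)
  have A_lin: "(\<lambda>x. of_real (l (torus_map x))) \<in> A" if "bounded_linear l" for l :: "complex^'n \<Rightarrow> real"
  proof -
    interpret bounded_linear l by fact
    let ?c = "\<lambda>i::'n. character (int_vec (axis i 1))" and ?d = "\<lambda>i::'n. character (int_vec (axis i (-1)))"
    have e: "int_vec (axis i a) = axis i (of_int a)" for i :: 'n and a
      by (simp add: int_vec_def axis_def vec_eq_iff)
    have c: "?c i x = cis (2 * pi * x $ i)" "?d i x = cis (- (2 * pi * x $ i))" for i x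
      by (simp_all add: character_def e inner_axis')
    have l: "l (torus_map x) = (\<Sum>i\<in>UNIV. cos (2 * pi * x $ i) * l (axis i 1) + sin (2 * pi * x $ i) * l (axis i \<i>))" for x
    proof -
      have "torus_map x = (\<Sum>i\<in>UNIV. cos (2 * pi * x $ i) *\<^sub>R axis i 1 + sin (2 * pi * x $ i) *\<^sub>R axis i \<i>)"
        by (simp add: vec_eq_iff torus_map_def axis_def complex_eq_iff if_distrib cong: if_cong)
      then show ?thesis by (simp add: sum add scaleR)
    qed
    \<comment> \<open>Euler's formulas, with \<open>?c i\<close> and \<open>?d i\<close> the
      characters of frequency 1 and -1 in coordinate \<open>i\<close>.\<close>
    have "complex_of_real (l (torus_map x)) =
        (\<Sum>i\<in>UNIV. (of_real (l (axis i 1)) / 2 + of_real (l (axis i \<i>)) / (2 * \<i>)) * ?c i x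
           + (of_real (l (axis i 1)) / 2 - of_real (l (axis i \<i>)) / (2 * \<i>)) * ?d i x)" for x
      unfolding l c of_real_sum
      by (intro sum.cong refl) (simp add: complex_eq_iff algebra_simps divide_simps)
    moreover have "(\<lambda>x. \<Sum>i\<in>UNIV. (of_real (l (axis i 1)) / 2 + of_real (l (axis i \<i>)) / (2 * \<i>)) * ?c i x
           + (of_real (l (axis i 1)) / 2 - of_real (l (axis i \<i>)) / (2 * \<i>)) * ?d i x) \<in> A"
      by (intro A_sum A_add A_mult A_const A_char) simp
    ultimately show ?thesis by presburger
  qed
  have A_poly: "(\<lambda>x. of_real (p (torus_map x))) \<in> A" if "real_polynomial_function p"
    for p :: "complex^'n \<Rightarrow> real"
    using that by (induction) (auto simp: A_lin A_const A_add A_mult)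
  \<comment> \<open>This is the hypothesis \<open>eq\<close>. Every multiplier in \<open>A\<close>
    is thereby itself in \<open>V\<close>, and the index \<open>m = 0\<close> then says that
    \<open>D\<close> vanishes on it.\<close>
  have one: "(\<lambda>x. 1) \<in> V"
    using eq by (auto simp: V_def bb_const D_def)
  have D_poly: "D (\<lambda>x. of_real (p (torus_map x))) = 0" if "real_polynomial_function p"
    for p :: "complex^'n \<Rightarrow> real"
  proof -
    have "\<forall>h\<in>V. (\<lambda>x. of_real (p (torus_map x)) * h x) \<in> V"
      using A_poly[OF that] by (simp add: A_def)
    from bspec[OF this one] have "D (\<lambda>x. character (int_vec 0) x * (of_real (p (torus_map x)) * 1)) = 0"
      unfolding V_def by blast
    then show ?thesis by simp
  qed
  \<comment> \<open>The radius \<open>CARD('n)\<close> bounds the sum of the moduli of the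
    coordinates, each of which is 1.\<close>
  have nT: "norm (torus_map x) \<le> CARD('n)" for x :: "real^'n"
    unfolding norm_vec_def by (rule order_trans[OF L2_set_le_sum]) (simp_all add: torus_map_def)
  have bbg: "bb (\<lambda>x. of_real (f (torus_map x)))" if f: "continuous_on UNIV f" for f :: "complex^'n \<Rightarrow> real"
  proof -
    have "compact (f ` cball 0 (CARD('n)))"
      by (intro compact_continuous_image continuous_on_subset[OF f]) auto
    then obtain B where "\<And>z. z \<in> cball 0 (CARD('n)) \<Longrightarrow> norm (f z) \<le> B"
      by (meson bounded_iff compact_imp_bounded imageI)
    moreover have "f \<in> borel_measurable borel" using f by (rule borel_measurable_continuous_onI)
    ultimately show ?thesis using nT by (auto simp: bb_def intro!: exI[of _ B])
  qed
  define K where "K = (LINT s|M. norm (u s)) + (LINT s|N. norm (v s))"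
  have K0: "0 \<le> K" by (simp add: K_def)
  have bound: "norm (D f) \<le> e * K" if f: "bb f" and e: "\<And>x. norm (f x) \<le> e" for f e
  proof -
    have "norm (LINT s|M. f (X s) * u s) \<le> (LINT s|M. e * norm (u s))"
      using bb_int[OF f, THEN integrable_norm] u e by (intro order_trans[OF integral_norm_bound] integral_mono)
        (auto simp: norm_mult intro!: mult_right_mono)
    moreover have "norm (LINT s|N. f (Y s) * v s) \<le> (LINT s|N. e * norm (v s))"
      using bb_int[OF f, THEN integrable_norm] v e by (intro order_trans[OF integral_norm_bound] integral_mono)
        (auto simp: norm_mult intro!: mult_right_mono)
    ultimately show ?thesis unfolding D_def K_def
      by (intro order_trans[OF norm_triangle_ineq4]) (simp add: distrib_left)
  qed
  have small: "norm (D (\<lambda>x. of_real (g (torus_map x)))) \<le> e * K" if e: "e > 0" for e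
  proof -
    have cg: "continuous_on (cball 0 (CARD('n))) g" by (rule continuous_on_subset[OF g subset_UNIV])
    obtain p where p: "real_polynomial_function p" and pe: "\<And>z. z \<in> cball 0 (CARD('n)) \<Longrightarrow> \<bar>g z - p z\<bar> < e"
      using Stone_Weierstrass_real_polynomial_function[OF compact_cball cg e]
      by metis
    have cp: "continuous_on UNIV p"
      using p by (simp add: continuous_on_polymonial_function real_polynomial_function_eq)
    let ?d = "\<lambda>x. complex_of_real (g (torus_map x)) + - 1 * of_real (p (torus_map x))"
    have "D ?d = D (\<lambda>x. of_real (g (torus_map x))) + D (\<lambda>x. - 1 * of_real (p (torus_map x)))"
      by (intro D_add bbg g bb_mult bb_const cp)
    also have "\<dots> = D (\<lambda>x. of_real (g (torus_map x)))"
      unfolding D_scale D_poly[OF p] by simp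
    moreover have "norm (D ?d) \<le> e * K"
    proof (rule bound)
      show "bb ?d" by (intro bb_add bbg g bb_mult bb_const cp)
      fix x
      have "?d x = of_real (g (torus_map x) - p (torus_map x))" by simp
      then have "norm (?d x) = \<bar>g (torus_map x) - p (torus_map x)\<bar>" by (metis norm_of_real)
      then show "norm (?d x) \<le> e" using pe[of "torus_map x"] nT[of x] by (simp add: less_imp_le)
    qed
    ultimately show ?thesis by simp
  qed
  have "norm (D (\<lambda>x. of_real (g (torus_map x)))) \<le> 0"
  proof (rule field_le_epsilon)
    fix e :: real assume "e > 0"
    \<comment> \<open>Adding 1 keeps the divisor positive when both weights vanish almost everywhere
      and \<open>K = 0\<close>.\<close>
    have "norm (D (\<lambda>x. of_real (g (torus_map x)))) \<le> e / (K + 1) * K"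
      using \<open>e > 0\<close> K0 by (intro small) auto
    also have "\<dots> \<le> e" using \<open>e > 0\<close> K0 by (simp add: divide_simps)
    finally show "norm (D (\<lambda>x. of_real (g (torus_map x)))) \<le> 0 + e" by simp
  qed
  then show ?thesis by (simp add: D_def)
qed

text \<open>Closed sets are stable under intersection and generate the Borel sets, and the equation
  passes to complements and disjoint unions; only indicators of closed sets have to be approximated
  by continuous functions. Bounding the test functions by 1 hands the caller a dominating
  function.\<close>

lemma borel_unique_of_continuous:
  fixes X :: "'a \<Rightarrow> 'c::metric_space" and Y :: "'b \<Rightarrow> 'c"
    and u :: "'a \<Rightarrow> complex" and v :: "'b \<Rightarrow> complex"
  assumes X [measurable]: "X \<in> borel_measurable M" and Y [measurable]: "Y \<in> borel_measurable N"
    and u: "integrable M u" and v: "integrable N v"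
    and eq: "\<And>g::'c \<Rightarrow> real. continuous_on UNIV g \<Longrightarrow> (\<And>z. 0 \<le> g z \<and> g z \<le> 1) \<Longrightarrow>
       (LINT s|M. of_real (g (X s)) * u s) = (LINT s|N. of_real (g (Y s)) * v s)"
    and A: "A \<in> sets borel"
  shows "(LINT s|M. indicator A (X s) * u s) = (LINT s|N. indicator A (Y s) * v s)"
proof -
  have [measurable]: "u \<in> borel_measurable M" "v \<in> borel_measurable N" using u v by auto
  have intM: "integrable M (\<lambda>s. indicator S (X s) * u s)" if [measurable]: "S \<in> sets borel" for S
    by (rule bounded_integrable_mult[OF _ u, of _ 1]) (auto split: split_indicator)
  have intN: "integrable N (\<lambda>s. indicator S (Y s) * v s)" if [measurable]: "S \<in> sets borel" for S
    by (rule bounded_integrable_mult[OF _ v, of _ 1]) (auto split: split_indicator)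
  \<comment> \<open>Equality of the total masses, for the complement case below.\<close>
  have all: "(LINT s|M. u s) = (LINT s|N. v s)" using eq[of "\<lambda>_. 1"] by simp
  have "Int_stable (Collect closed :: 'c set set)" by (auto simp: Int_stable_def)
  moreover have "Collect closed \<subseteq> Pow (UNIV::'c set)" by simp
  moreover have "A \<in> sigma_sets UNIV (Collect closed)" using A unfolding borel_eq_closed by simp
  ultimately show ?thesis
  proof (induction rule: sigma_sets_induct_disjoint)
    fix C :: "'c set" assume "C \<in> Collect closed"
    then have C: "closed C" by simp
    show "(LINT s|M. indicator C (X s) * u s) = (LINT s|N. indicator C (Y s) * v s)"
    proof (cases "C = {}")
      case False
      \<comment> \<open>For \<open>k > 0\<close> these cut-offs are 1 on \<open>C\<close> and 0 at
        distance at least \<open>1 / k\<close> from it. The empty set is treated apart because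
        \<open>infdist z {} = 0\<close> by convention, so there the cut-offs would be constantly
        1.\<close>
      define g where "g k z = max 0 (1 - real k * infdist z C)" for k z
      have cg: "continuous_on UNIV (g k)" for k
        unfolding g_def by (intro continuous_intros continuous_on_max continuous_on_infdist)
      have [measurable]: "g k \<in> borel_measurable borel" for k
        by (rule borel_measurable_continuous_onI[OF cg])
      have g01: "0 \<le> g k z \<and> g k z \<le> 1" for k z by (simp add: g_def infdist_nonneg)
      have lim: "(\<lambda>k. complex_of_real (g k z)) \<longlonglongrightarrow> indicator C z" for z
      proof (cases "z \<in> C")
        case True then show ?thesis by (simp add: g_def)
      next
        case z: False
        then have pos: "0 < infdist z C"
          using C False by (simp add: infdist_pos_not_in_closed)
        obtain k0 where k0: "1 < real k0 * infdist z C"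
          using pos reals_Archimedean3 by blast
        have "eventually (\<lambda>k. complex_of_real (g k z) = 0) sequentially"
          using eventually_ge_at_top[of k0]
        proof eventually_elim
          case (elim k)
          have "real k0 * infdist z C \<le> real k * infdist z C"
            using elim pos by (intro mult_right_mono) auto
          then show ?case using k0 by (simp add: g_def)
        qed
        then show ?thesis using z by (simp add: tendsto_eventually)
      qed
      have "(\<lambda>k. LINT s|M. of_real (g k (X s)) * u s) \<longlonglongrightarrow> (LINT s|M. indicator C (X s) * u s)"
      proof (rule integral_dominated_convergence[where w="\<lambda>s. norm (u s)"])
        show "AE s in M. (\<lambda>k. of_real (g k (X s)) * u s) \<longlonglongrightarrow> indicator C (X s) * u s"
          by (intro AE_I2 tendsto_mult_right lim)
        show "AE s in M. norm (of_real (g k (X s)) * u s) \<le> norm (u s)" for k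
          using g01 by (intro AE_I2) (auto simp: norm_mult intro!: mult_left_le_one_le)
      qed (use C u in \<open>auto intro!: borel_measurable_times borel_measurable_of_real measurable_compose[OF X]
            measurable_compose[OF X borel_measurable_indicator]\<close>)
      moreover have "(\<lambda>k. LINT s|N. of_real (g k (Y s)) * v s) \<longlonglongrightarrow> (LINT s|N. indicator C (Y s) * v s)"
      proof (rule integral_dominated_convergence[where w="\<lambda>s. norm (v s)"])
        show "AE s in N. (\<lambda>k. of_real (g k (Y s)) * v s) \<longlonglongrightarrow> indicator C (Y s) * v s"
          by (intro AE_I2 tendsto_mult_right lim)
        show "AE s in N. norm (of_real (g k (Y s)) * v s) \<le> norm (v s)" for k
          using g01 by (intro AE_I2) (auto simp: norm_mult intro!: mult_left_le_one_le)
      qed (use C v in \<open>auto intro!: borel_measurable_times borel_measurable_of_real measurable_compose[OF Y]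
            measurable_compose[OF Y borel_measurable_indicator]\<close>)
      ultimately show ?thesis unfolding eq[OF cg g01] by (rule LIMSEQ_unique)
    qed simp
  next
    show "(LINT s|M. indicator {} (X s) * u s) = (LINT s|N. indicator {} (Y s) * v s)" by simp
  next
    fix S :: "'c set" assume "S \<in> sigma_sets UNIV (Collect closed)"
      and IH: "(LINT s|M. indicator S (X s) * u s) = (LINT s|N. indicator S (Y s) * v s)"
    then have S: "S \<in> sets borel" unfolding borel_eq_closed by simp
    have "indicator (UNIV - S) z * w = w - indicator S z * w" for z and w :: complex
      by (auto split: split_indicator)
    then show "(LINT s|M. indicator (UNIV - S) (X s) * u s) = (LINT s|N. indicator (UNIV - S) (Y s) * v s)"
      using intM[OF S] intN[OF S] u v IH all by simp
  next
    fix S :: "nat \<Rightarrow> 'c set" assume dis: "disjoint_family S"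
      and "range S \<subseteq> sigma_sets UNIV (Collect closed)"
      and IH: "\<And>i. (LINT s|M. indicator (S i) (X s) * u s) = (LINT s|N. indicator (S i) (Y s) * v s)"
    then have S [measurable]: "S i \<in> sets borel" for i unfolding borel_eq_closed by auto
    have fin: "(\<Sum>i<k. indicator (S i) z) = (indicator (\<Union>i<k. S i) z :: complex)" for k z
      by (rule indicator_UN_disjoint[symmetric]) (use dis in \<open>auto simp: disjoint_family_on_def\<close>)
    have lim: "(\<lambda>k. indicator (\<Union>i<k. S i) z :: complex) \<longlonglongrightarrow> indicator (\<Union>i. S i) z" for z
      by (rule LIMSEQ_indicator_UN)
    have "(\<lambda>k. LINT s|M. indicator (\<Union>i<k. S i) (X s) * u s) \<longlonglongrightarrow> (LINT s|M. indicator (\<Union>i. S i) (X s) * u s)"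
    proof (rule integral_dominated_convergence[where w="\<lambda>s. norm (u s)"])
      show "AE s in M. (\<lambda>k. indicator (\<Union>i<k. S i) (X s) * u s) \<longlonglongrightarrow> indicator (\<Union>i. S i) (X s) * u s"
        by (intro AE_I2 tendsto_mult_right lim)
      show "AE s in M. norm (indicator (\<Union>i<k. S i) (X s) * u s) \<le> norm (u s)" for k
        by (intro AE_I2) (auto simp: norm_mult split: split_indicator)
    qed (use u in \<open>auto intro!: borel_measurable_integrable[OF intM]\<close>)
    moreover have "(\<lambda>k. LINT s|N. indicator (\<Union>i<k. S i) (Y s) * v s) \<longlonglongrightarrow> (LINT s|N. indicator (\<Union>i. S i) (Y s) * v s)"
    proof (rule integral_dominated_convergence[where w="\<lambda>s. norm (v s)"])
      show "AE s in N. (\<lambda>k. indicator (\<Union>i<k. S i) (Y s) * v s) \<longlonglongrightarrow> indicator (\<Union>i. S i) (Y s) * v s"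
        by (intro AE_I2 tendsto_mult_right lim)
      show "AE s in N. norm (indicator (\<Union>i<k. S i) (Y s) * v s) \<le> norm (v s)" for k
        by (intro AE_I2) (auto simp: norm_mult split: split_indicator)
    qed (use v in \<open>auto intro!: borel_measurable_integrable[OF intN]\<close>)
    moreover have "(LINT s|M. indicator (\<Union>i<k. S i) (X s) * u s) = (LINT s|N. indicator (\<Union>i<k. S i) (Y s) * v s)" for k
      unfolding fin[symmetric] sum_distrib_right
      using intM[OF S] intN[OF S] IH by (simp only: Bochner_Integration.integral_sum)
    ultimately show "(LINT s|M. indicator (\<Union>i. S i) (X s) * u s) = (LINT s|N. indicator (\<Union>i. S i) (Y s) * v s)"
      using LIMSEQ_unique by simp
  qed
qed

section \<open>Finite complex measures as densities\<close>

lemma finite_cm_dom: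
  assumes "\<mu> \<in> sigma_finite_complex_measures" "finite_cm \<mu>"
  shows "dom \<mu> = sets borel"
  using finite_cm_iff[THEN iffD1, OF conjI[OF assms]] by (rule conjunct1)

lemma finite_cm_sums:
  fixes A :: "nat \<Rightarrow> (real^'n) set"
  assumes \<mu>: "\<mu> \<in> sigma_finite_complex_measures" "finite_cm \<mu>"
    and A: "\<And>i. A i \<in> sets borel" "disjoint_family A"
  shows "(\<lambda>i. the (\<mu> (A i))) sums the (\<mu> (\<Union>i. A i))"
  using finite_cm_iff[THEN iffD1, OF conjI[OF \<mu>], THEN conjunct2, rule_format, of A] A by auto

lemma finite_cm_empty:
  fixes \<mu> :: "(real^'n) set \<rightharpoonup> complex"
  assumes "\<mu> \<in> sigma_finite_complex_measures" "finite_cm \<mu>"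
  shows "the (\<mu> {}) = 0"
proof -
  have "(\<lambda>i::nat. the (\<mu> {})) sums the (\<mu> (\<Union>i::nat. {}))"
    by (rule finite_cm_sums[OF assms]) (auto simp: disjoint_family_on_def)
  then have "(\<lambda>i::nat. the (\<mu> {})) \<longlonglongrightarrow> 0" by (intro summable_LIMSEQ_zero sums_summable)
  then show ?thesis by (simp add: LIMSEQ_const_iff)
qed

lemma finite_cm_diff:
  fixes \<mu> :: "(real^'n) set \<rightharpoonup> complex"
  assumes \<mu>: "\<mu> \<in> sigma_finite_complex_measures" "finite_cm \<mu>"
    and A: "A \<in> sets borel" and B: "B \<in> sets borel" and sub: "B \<subseteq> A"
  shows "the (\<mu> (A - B)) = the (\<mu> A) - the (\<mu> B)"
proof -
  have u: "(\<Union>i. binaryset B (A - B) i) = A" using sub by (auto simp: UN_binaryset_eq)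
  have "(\<lambda>i. the (\<mu> (binaryset B (A - B) i))) sums the (\<mu> (\<Union>i. binaryset B (A - B) i))"
    by (rule finite_cm_sums[OF \<mu>]) (use A B in \<open>auto simp: binaryset_def disjoint_family_on_def\<close>)
  moreover have "(\<lambda>i. the (\<mu> (binaryset B (A - B) i))) sums (the (\<mu> B) + the (\<mu> (A - B)))"
    using binaryset_sums[of "\<lambda>A. the (\<mu> A)"] finite_cm_empty[OF \<mu>] by auto
  ultimately have "the (\<mu> A) = the (\<mu> B) + the (\<mu> (A - B))" unfolding u by (rule sums_unique2)
  then show ?thesis by simp
qed

lemma emeasure_jordan_part_finite_cm:
  fixes \<mu> :: "(real^'n) set \<rightharpoonup> complex"
  assumes \<mu>: "\<mu> \<in> sigma_finite_complex_measures" "finite_cm \<mu>" and A: "A \<in> sets borel"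
  shows "emeasure (jordan_part c \<mu>) A = (SUP B \<in> {B \<in> sets borel. B \<subseteq> A}. ennreal (Re (c * the (\<mu> B))))"
  using emeasure_jordan_part[OF \<mu>(1) A, of c] unfolding finite_cm_dom[OF \<mu>] .

text \<open>Otherwise a set of infinite variation could be cut repeatedly into a piece of infinite
  variation and a remainder of value at least 1 in modulus, and the values of these disjoint
  remainders would not be summable.\<close>

lemma finite_measure_jordan_part:
  fixes \<mu> :: "(real^'n) set \<rightharpoonup> complex"
  assumes \<mu>: "\<mu> \<in> sigma_finite_complex_measures" "finite_cm \<mu>"
  shows "finite_measure (jordan_part c \<mu>)"
proof (rule ccontr)
  define r where "r A = Re (c * the (\<mu> A))" for A
  \<comment> \<open>The parts for \<open>c\<close> and \<open>- c\<close> together give the total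
    variation of the real measure \<open>r\<close>. Where it is infinite, one of two suprema is
    infinite, so \<open>r\<close> is unbounded on subsets.\<close>
  define V where "V A = emeasure (jordan_part c \<mu>) A + emeasure (jordan_part (- c) \<mu>) A" for A
  have V_split: "V A = V B + V (A - B)" if "A \<in> sets borel" "B \<in> sets borel" "B \<subseteq> A" for A B
  proof -
    have "emeasure (jordan_part d \<mu>) A = emeasure (jordan_part d \<mu>) B + emeasure (jordan_part d \<mu>) (A - B)" for d
      using that by (subst plus_emeasure) (auto simp: Un_absorb1)
    then show ?thesis unfolding V_def by (simp add: ac_simps)
  qed
  have big: "\<exists>B\<in>sets borel. B \<subseteq> A \<and> K < \<bar>r B\<bar>" if A: "A \<in> sets borel" and inf: "V A = \<infinity>" for A K
  proof -
    have "\<exists>d\<in>{c, -c}. emeasure (jordan_part d \<mu>) A = \<infinity>"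
      using inf unfolding V_def by auto
    then obtain d where d: "d \<in> {c, -c}" "emeasure (jordan_part d \<mu>) A = \<infinity>" by blast
    then have "ennreal \<bar>K\<bar> < (SUP B \<in> {B \<in> sets borel. B \<subseteq> A}. ennreal (Re (d * the (\<mu> B))))"
      unfolding emeasure_jordan_part_finite_cm[OF \<mu> A] by (simp only: infinity_ennreal_def ennreal_less_top)
    then obtain B where "B \<in> sets borel" "B \<subseteq> A" "ennreal \<bar>K\<bar> < ennreal (Re (d * the (\<mu> B)))"
      unfolding less_SUP_iff by auto
    moreover from this have "\<bar>K\<bar> < Re (d * the (\<mu> B))"
      by (simp add: ennreal_less_iff)
    then have "K < \<bar>r B\<bar>" using d(1) by (auto simp: r_def)
    ultimately show ?thesis by blast
  qed
  have step: "\<exists>A'\<in>sets borel. A' \<subseteq> A \<and> V A' = \<infinity> \<and> 1 < \<bar>r (A - A')\<bar>"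
    if A: "A \<in> sets borel" and inf: "V A = \<infinity>" for A
  proof -
    \<comment> \<open>Exceeding \<open>\<bar>r A\<bar> + 1\<close> makes both \<open>r B\<close> and
      \<open>r (A - B)\<close> larger than 1 in modulus. Whichever of the two pieces has infinite
      variation can be kept, and the other is the remainder.\<close>
    obtain B where B: "B \<in> sets borel" "B \<subseteq> A" "\<bar>r A\<bar> + 1 < \<bar>r B\<bar>"
      using big[OF A inf] by blast
    have r: "r (A - B) = r A - r B"
      unfolding r_def finite_cm_diff[OF \<mu> A B(1,2)] by (simp add: right_diff_distrib)
    have "V B + V (A - B) = \<infinity>" using V_split[OF A B(1,2)] inf by (rule subst)
    then have "V B = \<infinity> \<or> V (A - B) = \<infinity>"
      by (simp only: infinity_ennreal_def ennreal_add_eq_top)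
    then show ?thesis
    proof
      assume "V B = \<infinity>"
      moreover have "1 < \<bar>r (A - B)\<bar>" using r B(3) by linarith
      ultimately show ?thesis using B by blast
    next
      assume "V (A - B) = \<infinity>"
      moreover have "A - (A - B) = B" using B(2) by blast
      moreover have "1 < \<bar>r B\<bar>" using B(3) by linarith
      ultimately show ?thesis using A B by (intro bexI[of _ "A - B"]) (simp_all only: sets.Diff Diff_subset simp_thms)
    qed
  qed
  assume "\<not> finite_measure (jordan_part c \<mu>)"
  then have "emeasure (jordan_part c \<mu>) UNIV = \<infinity>"
    using finite_measureI[of "jordan_part c \<mu>"] by auto
  then have "V UNIV = \<infinity>" by (simp add: V_def)
  then have "\<exists>A. \<forall>n. (A n \<in> sets borel \<and> V (A n) = \<infinity>) \<and> (A (Suc n) \<subseteq> A n \<and> 1 < \<bar>r (A n - A (Suc n))\<bar>)"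
  proof (intro dependent_nat_choice)
    show "\<exists>A. A \<in> sets borel \<and> V A = \<infinity>"
      using \<open>V UNIV = \<infinity>\<close> by (intro exI[of _ UNIV]) simp
    show "\<exists>B. (B \<in> sets borel \<and> V B = \<infinity>) \<and> (B \<subseteq> A \<and> 1 < \<bar>r (A - B)\<bar>)"
      if "A \<in> sets borel \<and> V A = \<infinity>" for A :: "(real^'n) set" and n :: nat
      using step[of A] that by blast
  qed
  then obtain A :: "nat \<Rightarrow> (real^'n) set" where A: "\<And>n. A n \<in> sets borel" "\<And>n. A (Suc n) \<subseteq> A n"
    "\<And>n. 1 < \<bar>r (A n - A (Suc n))\<bar>" by blast
  have dec: "m \<le> n \<Longrightarrow> A n \<subseteq> A m" for m n
    using A(2) by (rule lift_Suc_antimono_le)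
  have "disjoint_family (\<lambda>n. A n - A (Suc n))"
    unfolding disjoint_family_on_def
  proof (intro ballI impI)
    fix m n :: nat assume "m \<noteq> n"
    then have "Suc m \<le> n \<or> Suc n \<le> m" by linarith
    then show "(A m - A (Suc m)) \<inter> (A n - A (Suc n)) = {}"
      using dec[of "Suc m" n] dec[of "Suc n" m] by blast
  qed
  then have "(\<lambda>n. the (\<mu> (A n - A (Suc n)))) sums the (\<mu> (\<Union>n. A n - A (Suc n)))"
    using A by (intro finite_cm_sums[OF \<mu>]) auto
  then have "(\<lambda>n. Re (c * the (\<mu> (A n - A (Suc n))))) sums Re (c * the (\<mu> (\<Union>n. A n - A (Suc n))))"
    by (intro sums_Re sums_mult)
  then have "(\<lambda>n. r (A n - A (Suc n))) \<longlonglongrightarrow> 0"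
    unfolding r_def by (intro summable_LIMSEQ_zero sums_summable)
  then have "eventually (\<lambda>n. \<bar>r (A n - A (Suc n))\<bar> < 1) sequentially"
    using tendsto_rabs_zero by (intro order_tendstoD(2)) auto
  then obtain n where "\<bar>r (A n - A (Suc n))\<bar> < 1" by (meson eventually_happens' sequentially_bot)
  with A(3)[of n] show False by linarith
qed

text \<open>For \<open>B \<subseteq> A\<close> the value on \<open>B\<close> is the value on
  \<open>A\<close> minus that on \<open>A - B\<close>, and the latter is controlled by the opposite
  part. Taking the supremum over \<open>B\<close> gives one inequality, and exchanging
  \<open>c\<close> with \<open>- c\<close> gives the other.\<close>

lemma jordan_decomposition:
  fixes \<mu> :: "(real^'n) set \<rightharpoonup> complex"
  assumes \<mu>: "\<mu> \<in> sigma_finite_complex_measures" "finite_cm \<mu>" and A: "A \<in> sets borel"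
  shows "measure (jordan_part c \<mu>) A - measure (jordan_part (- c) \<mu>) A = Re (c * the (\<mu> A))"
proof -
  have up: "Re (d * the (\<mu> B)) \<le> measure (jordan_part d \<mu>) A" if "B \<in> sets borel" "B \<subseteq> A" for B d
  proof -
    interpret finite_measure "jordan_part d \<mu>" by (rule finite_measure_jordan_part[OF \<mu>])
    have "ennreal (Re (d * the (\<mu> B))) \<le> emeasure (jordan_part d \<mu>) A"
      unfolding emeasure_jordan_part_finite_cm[OF \<mu> A] using that by (intro SUP_upper) auto
    then show ?thesis by (simp add: emeasure_eq_measure)
  qed
  have le: "measure (jordan_part d \<mu>) A \<le> Re (d * the (\<mu> A)) + measure (jordan_part (- d) \<mu>) A" for d
  proof -
    interpret finite_measure "jordan_part d \<mu>" by (rule finite_measure_jordan_part[OF \<mu>])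
    have pos: "0 \<le> Re (d * the (\<mu> A)) + measure (jordan_part (- d) \<mu>) A"
      using up[OF A, of "-d"] by simp
    have "emeasure (jordan_part d \<mu>) A \<le> ennreal (Re (d * the (\<mu> A)) + measure (jordan_part (- d) \<mu>) A)"
      unfolding emeasure_jordan_part_finite_cm[OF \<mu> A]
    proof (rule SUP_least, rule ennreal_leI)
      fix B :: "(real^'n) set" assume B: "B \<in> {B \<in> sets borel. B \<subseteq> A}"
      then have "Re (- d * the (\<mu> (A - B))) \<le> measure (jordan_part (- d) \<mu>) A"
        using A by (intro up) auto
      moreover have "the (\<mu> (A - B)) = the (\<mu> A) - the (\<mu> B)"
        using B A by (intro finite_cm_diff[OF \<mu>]) auto
      ultimately show "Re (d * the (\<mu> B)) \<le> Re (d * the (\<mu> A)) + measure (jordan_part (- d) \<mu>) A"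
        by (simp add: algebra_simps)
    qed
    then show ?thesis using pos by (simp add: emeasure_eq_measure)
  qed
  from le[of c] le[of "- c"] show ?thesis by simp
qed

text \<open>All four Jordan parts are absolutely continuous with respect to their sum
  \<open>M\<close>, so Radon--Nikodym turns the complex measure into a single integrable weight
  \<open>w\<close> over a finite positive measure. From here on only ordinary Bochner integrals
  occur.\<close>

lemma finite_cm_density:
  fixes \<mu> :: "(real^'n) set \<rightharpoonup> complex"
  assumes \<mu>: "\<mu> \<in> sigma_finite_complex_measures" "finite_cm \<mu>"
  obtains M :: "(real^'n) measure" and w :: "real^'n \<Rightarrow> complex"
  where "sets M = sets borel" "integrable M w"
    "\<And>h B. h \<in> borel_measurable borel \<Longrightarrow> (\<And>x. norm (h x) \<le> B) \<Longrightarrow>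
       integral_cm \<mu> h = (LINT x|M. h x * w x)"
    "\<And>A. A \<in> sets borel \<Longrightarrow> the (\<mu> A) = (LINT x|M. indicator A x * w x)"
    "\<And>F. supported_cm \<mu> F \<Longrightarrow> F \<in> sets borel \<Longrightarrow> AE x in M. x \<in> F"
proof -
  define J where "J c = jordan_part c \<mu>" for c
  have fJ: "finite_measure (J c)" for c unfolding J_def by (rule finite_measure_jordan_part[OF \<mu>])
  have sJ [simp, measurable_cong]: "sets (J c) = sets borel" "space (J c) = UNIV" for c by (simp_all add: J_def)
  define C where "C = {1, -1, -\<i>, \<i>}"
  have finC: "finite C" by (simp add: C_def)
  define f where "f A = (\<Sum>c\<in>C. emeasure (J c) A)" for A
  define M where "M = measure_of UNIV (sets (borel :: (real^'n) measure)) f"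
  have sM [simp, measurable_cong]: "sets M = sets borel" and spM [simp]: "space M = UNIV"
    using sets.sigma_sets_eq[of "borel :: (real^'n) measure"] by (simp_all add: M_def)
  have eM: "emeasure M A = f A" if "A \<in> sets borel" for A
  proof (rule emeasure_measure_of[OF M_def])
    show "positive (sets M) f" by (simp add: positive_def f_def)
    show "countably_additive (sets M) f"
    proof (rule countably_additiveI)
      fix X :: "nat \<Rightarrow> (real^'n) set"
      assume X: "range X \<subseteq> sets M" "disjoint_family X"
      have "(\<Sum>i. f (X i)) = (\<Sum>c\<in>C. \<Sum>i. emeasure (J c) (X i))"
        unfolding f_def by (rule suminf_sum) auto
      also have "\<dots> = f (\<Union>i. X i)"
        unfolding f_def using X by (intro sum.cong refl suminf_emeasure) auto
      finally show "(\<Sum>i. f (X i)) = f (\<Union>i. X i)" .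
    qed
  qed (use that in auto)
  interpret M: finite_measure M
    by (rule finite_measureI) (auto simp: eM f_def C_def finite_measure.emeasure_finite[OF fJ])
  have ac: "absolutely_continuous M (J c)" if "c \<in> C" for c
    using that finC by (auto simp: absolutely_continuous_def null_sets_def eM f_def)
  have "\<exists>D. D \<in> borel_measurable M \<and> (\<forall>x. 0 \<le> D x) \<and> J c = density M (\<lambda>x. ennreal (D x))" if c: "c \<in> C" for c
  proof -
    obtain D where D: "D \<in> borel_measurable M" "AE x in M. RN_deriv M (J c) x = ennreal (D x)" "\<And>x. 0 \<le> D x"
      using M.real_RN_deriv[OF fJ ac[OF c]] by (metis sJ(1) sM)
    have "J c = density M (RN_deriv M (J c))"
      using M.density_RN_deriv[OF ac[OF c]] by simp
    also have "\<dots> = density M (\<lambda>x. ennreal (D x))"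
      using D by (intro density_cong) auto
    finally show ?thesis using D by blast
  qed
  then obtain D where D: "\<And>c. c \<in> C \<Longrightarrow> D c \<in> borel_measurable M" "\<And>c x. c \<in> C \<Longrightarrow> 0 \<le> D c x"
    "\<And>c. c \<in> C \<Longrightarrow> J c = density M (\<lambda>x. ennreal (D c x))" by metis
  have iD: "integrable M (D c)" if c: "c \<in> C" for c
  proof -
    interpret finite_measure "J c" by (rule fJ)
    have "integrable (J c) (\<lambda>_. 1::real)" by simp
    then show ?thesis using D[OF c] by (simp add: integrable_density)
  qed
  have LJ: "(LINT x|J c. h x) = (LINT x|M. h x * complex_of_real (D c x))"
    if c: "c \<in> C" and h: "h \<in> borel_measurable borel" for c and h :: "real^'n \<Rightarrow> complex"
    using D[OF c] h by (simp add: integral_density scaleR_conv_of_real mult.commute)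
  define w where "w x = (complex_of_real (D 1 x) - of_real (D (-1) x))
     + \<i> * (of_real (D (-\<i>) x) - of_real (D \<i> x))" for x
  have CC: "1 \<in> C" "-1 \<in> C" "-\<i> \<in> C" "\<i> \<in> C" by (auto simp: C_def)
  have iw: "integrable M w"
    unfolding w_def using CC
    by (intro Bochner_Integration.integrable_add Bochner_Integration.integrable_diff
        integrable_mult_right integrable_of_real iD) auto
  have int: "integral_cm \<mu> h = (LINT x|M. h x * w x)"
    if h: "h \<in> borel_measurable borel" and B: "\<And>x. norm (h x) \<le> B" for h B
  proof -
    have i: "integrable M (\<lambda>x. h x * complex_of_real (D c x))" if "c \<in> C" for c
      using h iD[OF that] B by (intro bounded_integrable_mult[of h M _ B]) auto
    have "(LINT x|M. h x * w x) = (LINT x|M. (h x * complex_of_real (D 1 x) - h x * of_real (D (-1) x))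
       + \<i> * (h x * of_real (D (-\<i>) x) - h x * of_real (D \<i> x)))"
      by (rule Bochner_Integration.integral_cong) (simp_all add: w_def algebra_simps)
    also have "\<dots> = integral_cm \<mu> h"
      unfolding integral_cm_def J_def[symmetric] using i[OF CC(1)] i[OF CC(2)] i[OF CC(3)] i[OF CC(4)]
      by (simp add: LJ[OF CC(1) h] LJ[OF CC(2) h] LJ[OF CC(3) h] LJ[OF CC(4) h])
    finally show ?thesis by simp
  qed
  show thesis
  proof
    show "sets M = sets borel" by (rule sM)
    show "integrable M w" by (rule iw)
    show "integral_cm \<mu> h = (LINT x|M. h x * w x)"
      if "h \<in> borel_measurable borel" "\<And>x. norm (h x) \<le> B" for h B using int that .
    show "the (\<mu> A) = (LINT x|M. indicator A x * w x)" if A: "A \<in> sets borel" for A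
    proof -
      have "integral_cm \<mu> (indicator A) = (LINT x|M. indicator A x * w x)"
        using A by (intro int[of _ 1]) (auto split: split_indicator)
      moreover have "integral_cm \<mu> (indicator A) = the (\<mu> A)"
      proof -
        have "(indicator A :: _ \<Rightarrow> complex) = (\<lambda>x. of_real (indicator A x))"
          by (auto split: split_indicator)
        then have L: "(LINT x|J c. indicator A x) = complex_of_real (measure (J c) A)" for c
          using A by (simp add: finite_measure.emeasure_finite[OF fJ])
        have "measure (J 1) A - measure (J (-1)) A = Re (the (\<mu> A))"
          using jordan_decomposition[OF \<mu> A, of 1] by (simp add: J_def)
        \<comment> \<open>\<open>Re (- \<i> * z) = Im z\<close>, so this value of \<open>c\<close>
          recovers the imaginary part.\<close>
        moreover have "measure (J (-\<i>)) A - measure (J \<i>) A = Im (the (\<mu> A))"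
          using jordan_decomposition[OF \<mu> A, of "-\<i>"] by (simp add: J_def)
        ultimately show ?thesis
          unfolding integral_cm_def J_def[symmetric] L of_real_diff[symmetric] by (simp add: complex_eq_iff)
      qed
      ultimately show ?thesis by simp
    qed
    show "AE x in M. x \<in> F" if F: "supported_cm \<mu> F" "F \<in> sets borel" for F
    proof -
      \<comment> \<open>Every Borel subset of the complement misses \<open>F\<close>, so the
        supremum that gives the part runs over zeros only.\<close>
      have "emeasure (J c) (- F) = 0" for c
      proof -
        have "emeasure (jordan_part c \<mu>) (- F) \<le> 0"
          unfolding emeasure_jordan_part_finite_cm[OF \<mu> borel_comp[OF F(2)]]
        proof (rule SUP_least)
          fix B assume "B \<in> {B \<in> sets borel. B \<subseteq> - F}"
          then have "B \<in> sets borel" "B \<inter> F = {}" by auto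
          then have "\<mu> B = Some 0" using F(1) unfolding supported_cm_def by blast
          then show "ennreal (Re (c * the (\<mu> B))) \<le> 0" by simp
        qed
        then show ?thesis unfolding J_def by simp
      qed
      then have "emeasure M (- F) = 0" using F(2) by (simp add: eM f_def)
      then show ?thesis using F(2) by (intro AE_I[of _ _ "- F"]) auto
    qed
  qed
qed

section \<open>Trigonometric polynomials and the unit cube\<close>

text \<open>\<open>lborel\<close> is the image of the product of one-dimensional Lebesgue measures
  over \<open>Basis\<close>, so a product of functions of separate coordinates integrates factor by
  factor.\<close>

lemma integral_lborel_prod:
  fixes f :: "'a::euclidean_space \<Rightarrow> real \<Rightarrow> complex"
  assumes f: "\<And>b. b \<in> Basis \<Longrightarrow> integrable lborel (f b)"
  shows "(LINT x|lborel. (\<Prod>b\<in>Basis. f b (x \<bullet> b))) = (\<Prod>b\<in>Basis. (LINT t|lborel. f b t))"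
proof -
  interpret product_sigma_finite "\<lambda>_::'a. lborel :: real measure" by standard
  have [measurable]: "b \<in> Basis \<Longrightarrow> f b \<in> borel_measurable borel" for b using f by fastforce
  have "(LINT x|lborel. (\<Prod>b\<in>Basis. f b (x \<bullet> b)))
      = (LINT g|(\<Pi>\<^sub>M b\<in>Basis. lborel). (\<Prod>b\<in>Basis. f b ((\<Sum>c\<in>Basis. g c *\<^sub>R c) \<bullet> b)))"
    by (subst lborel_eq, subst integral_distr) measurable
  also have "\<dots> = (LINT g|(\<Pi>\<^sub>M b\<in>Basis. lborel). (\<Prod>b\<in>Basis. f b (g b)))"
    by (simp cong: prod.cong)
  also have "\<dots> = (\<Prod>b\<in>Basis. (LINT t|lborel. f b t))"
    by (rule product_integral_prod) (use f in auto)
  finally show ?thesis .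
qed

lemma integral_cis_unit_interval:
  assumes "k \<in> \<int>"
  shows "(LINT t|lborel. indicator {0..<1} t * cis (2 * pi * (k * t))) = (if k = 0 then 1 else 0)"
proof -
  \<comment> \<open>The fundamental theorem is applied on the closed interval; the added endpoint is
    a null set.\<close>
  have "(LINT t|lborel. indicator {0..<1} t * cis (2 * pi * (k * t)))
      = (LINT t|lborel. indicator {0..1} t *\<^sub>R cis (2 * pi * (k * t)))"
  proof (rule integral_cong_AE)
    show "AE t in lborel. indicator {0..<1} t * cis (2 * pi * (k * t)) = indicator {0..1} t *\<^sub>R cis (2 * pi * (k * t))"
      using AE_lborel_singleton[of "1::real"]
      by eventually_elim (auto split: split_indicator)
  qed (simp_all add: cis_conv_exp)
  also have "\<dots> = (if k = 0 then 1 else 0)"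
  proof (cases "k = 0")
    case True
    have "(LINT t|lborel. indicator {0..1::real} t *\<^sub>R (1::complex)) = (LINT t|lborel. indicator {0..1::real} t) *\<^sub>R 1"
      by (rule integral_scaleR_left) (simp add: integrable_indicator_iff)
    also have "(LINT t|lborel. indicator {0..1::real} t) = (1::real)"
      by (subst Bochner_Integration.integral_indicator) simp
    finally have "(LINT t|lborel. indicator {0..1::real} t *\<^sub>R (1::complex)) = 1" by (simp only: scaleR_one)
    then show ?thesis using True by simp
  next
    case False
    define F where "F t = cis (2 * pi * (k * t)) / (2 * pi * k * \<i>)" for t
    have "(LINT t|lborel. indicator {0..1} t *\<^sub>R cis (2 * pi * (k * t))) = F 1 - F 0"
    proof (rule integral_FTC_Icc)
      fix t :: real assume "0 \<le> t" "t \<le> 1"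
      show "(F has_vector_derivative cis (2 * pi * (k * t))) (at t within {0..1})"
      proof -
        have "((\<lambda>z. exp (\<i> * (2 * pi * (k * z))) / (2 * pi * k * \<i>)) has_field_derivative
            exp (\<i> * (2 * pi * (k * of_real t)))) (at (of_real t))"
          using False by (auto intro!: derivative_eq_intros)
        from has_vector_derivative_real_field[OF this] show ?thesis
          by (simp add: F_def[abs_def] cis_conv_exp)
      qed
    qed (auto intro!: continuous_intros simp: cis_conv_exp)
    also have "\<dots> = 0"
      using cis_multiple_2pi[OF assms] by (simp add: F_def)
    finally show ?thesis using False by simp
  qed
  finally show ?thesis .
qed

text \<open>Half-open, so that its integer translates partition the space.\<close>

definition unit_cube :: "real^'n \<Rightarrow> (real^'n) set" where
  "unit_cube a = {x. \<forall>i. a $ i \<le> x $ i \<and> x $ i < a $ i + 1}"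

lemma borel_unit_cube [measurable]: "unit_cube a \<in> sets borel"
  unfolding unit_cube_def by measurable

lemma emeasure_unit_cube:
  fixes a :: "real^'n"
  shows "emeasure lborel (unit_cube a) = 1"
proof (rule antisym)
  have *: "(a + 1 - a) \<bullet> b = 1" if "b \<in> Basis" for b :: "real^'n"
    using that by (auto simp: Basis_vec_def inner_axis)
  have le: "a \<bullet> b \<le> (a + 1) \<bullet> b" if "b \<in> Basis" for b
    using *[OF that] by (simp add: inner_diff_left inner_add_left)
  have "unit_cube a \<subseteq> cbox a (a + 1)" "box a (a + 1) \<subseteq> unit_cube a"
    by (auto simp: unit_cube_def mem_box_cart less_imp_le)
  then have "emeasure lborel (unit_cube a) \<le> emeasure lborel (cbox a (a + 1))"
    "emeasure lborel (box a (a + 1)) \<le> emeasure lborel (unit_cube a)"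
    by (auto intro!: emeasure_mono)
  then show "emeasure lborel (unit_cube a) \<le> 1" "1 \<le> emeasure lborel (unit_cube a)"
    using le * by (simp_all add: emeasure_lborel_cbox_eq emeasure_lborel_box_eq prod.neutral)
qed

text \<open>Orthogonality of characters: the integrand factors over the coordinates, and a nonzero
  \<open>m\<close> has a coordinate whose factor integrates to 0.\<close>

lemma integral_character_unit_cube:
  fixes m :: "int^'n"
  shows "(LINT x|lborel. indicator (unit_cube 0) x * character (int_vec m) x) = (if m = 0 then 1 else 0)"
proof -
  let ?k = "int_vec m :: real^'n"
  define f where "f b t = indicator {0..<1} t * cis (2 * pi * ((?k \<bullet> b) * t))" for b t
  have k: "?k \<bullet> b \<in> \<int>" if "b \<in> Basis" for b
    using that by (auto simp: Basis_vec_def inner_axis int_vec_def)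
  have "indicator (unit_cube 0) x * character ?k x = (\<Prod>b\<in>Basis. f b (x \<bullet> b))" for x
  proof -
    have "(\<forall>i. P (x $ i)) \<longleftrightarrow> (\<forall>b\<in>Basis. P (x \<bullet> b))" for P
      by (auto simp: Basis_vec_def inner_axis)
    from this[of "\<lambda>t. t \<in> {0..<1}"]
    have "x \<in> unit_cube 0 \<longleftrightarrow> (\<forall>b\<in>Basis. x \<bullet> b \<in> {0..<1})"
      by (simp add: unit_cube_def)
    then have "indicator (unit_cube 0) x = (\<Prod>b\<in>Basis. indicator {0..<1} (x \<bullet> b) :: complex)"
      by (auto simp: indicator_def prod_zero_iff)
    moreover have "character ?k x = (\<Prod>b\<in>Basis. cis (2 * pi * ((?k \<bullet> b) * (x \<bullet> b))))"
      unfolding character_def euclidean_inner[of ?k x] cis_conv_exp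
      by (simp add: exp_sum[symmetric] sum_distrib_left)
    ultimately show ?thesis by (simp add: f_def prod.distrib)
  qed
  moreover have "integrable lborel (f b)" for b
  proof (rule Bochner_Integration.integrable_bound)
    show "integrable lborel (indicator {0..<1} :: real \<Rightarrow> real)" by simp
    show "f b \<in> borel_measurable lborel" unfolding f_def cis_conv_exp by measurable
  qed (auto simp: f_def norm_mult split: split_indicator)
  ultimately have "(LINT x|lborel. indicator (unit_cube 0) x * character ?k x)
      = (\<Prod>b\<in>Basis. (LINT t|lborel. f b t))"
    by (simp add: integral_lborel_prod)
  also have "\<dots> = (\<Prod>b\<in>Basis. if ?k \<bullet> b = 0 then 1 else 0)"
    unfolding f_def by (intro prod.cong refl integral_cis_unit_interval k)
  also have "\<dots> = (if \<forall>b\<in>Basis. ?k \<bullet> b = 0 then 1 else 0)"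
    by (auto simp: prod_zero_iff)
  also have "(\<forall>b\<in>Basis. ?k \<bullet> b = 0) \<longleftrightarrow> m = 0"
    by (auto simp: Basis_vec_def inner_axis int_vec_def vec_eq_iff)
  finally show ?thesis .
qed

lemma emeasure_lborel_affine:
  fixes t :: "'a::euclidean_space"
  assumes A [measurable]: "A \<in> sets borel" and c: "c \<noteq> 0"
  shows "emeasure lborel A = ennreal (\<bar>c\<bar> ^ DIM('a)) * emeasure lborel {x. t + c *\<^sub>R x \<in> A}"
proof -
  have "emeasure lborel A = emeasure (density (distr lborel borel (\<lambda>x. t + c *\<^sub>R x)) (\<lambda>_. ennreal (\<bar>c\<bar>^DIM('a)))) A"
    using lborel_affine[OF c, of t] by simp
  also have "\<dots> = ennreal (\<bar>c\<bar> ^ DIM('a)) * emeasure (distr lborel borel (\<lambda>x. t + c *\<^sub>R x)) A"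
    by (subst emeasure_density_const) auto
  also have "emeasure (distr lborel borel (\<lambda>x. t + c *\<^sub>R x)) A = emeasure lborel {x. t + c *\<^sub>R x \<in> A}"
    by (subst emeasure_distr) (auto simp: vimage_def)
  finally show ?thesis .
qed

text \<open>Along every ray through a point where it does not vanish, a trigonometric polynomial is a
  nonzero entire function of the parameter, so it vanishes only countably often there. By Tonelli
  some dilate of the zero set about that point is null.\<close>

lemma trig_polynomial_zeros_null:
  fixes c :: "int^'n \<Rightarrow> complex" and S :: "(int^'n) set"
  defines "P \<equiv> \<lambda>x. \<Sum>m\<in>S. c m * character (int_vec m) x"
  assumes x0: "P x0 \<noteq> 0"
  shows "AE x in lborel. P x \<noteq> 0"
proof -
  have P [measurable]: "P \<in> borel_measurable borel" unfolding P_def by measurable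
  have cnt: "countable {t::real. P (x0 + t *\<^sub>R v) = 0}" for v
  proof -
    \<comment> \<open>The restriction of \<open>P\<close> to the ray in direction \<open>v\<close>,
      with the real parameter made complex.\<close>
    define f where "f z = (\<Sum>m\<in>S. c m * character (int_vec m) x0 * exp (2 * pi * \<i> * (int_vec m \<bullet> v) * z))" for z :: complex
    have f: "P (x0 + t *\<^sub>R v) = f (of_real t)" for t
      by (simp add: P_def f_def character_add_right) (simp add: character_def cis_conv_exp mult_ac)
    have f0: "f 0 \<noteq> 0" using x0 f[of 0] by simp
    have "countable {z. f z = 0}"
    proof (cases "f constant_on UNIV")
      case True
      then have "{z. f z = 0} = {}" using f0 by (auto simp: constant_on_def)
      then show ?thesis by simp
    next
      case False
      have "f holomorphic_on UNIV" unfolding f_def by (intro holomorphic_intros)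
      from holomorphic_countable_zeros[OF this open_UNIV connected_UNIV _ False] show ?thesis by simp
    qed
    then have "countable (complex_of_real ` {t. P (x0 + t *\<^sub>R v) = 0})"
      by (rule countable_subset[rotated]) (auto simp: f)
    then show ?thesis by (rule countable_image_inj_on) (simp add: inj_on_def)
  qed
  define h where "h v t = (indicator {x. P x = 0} (x0 + t *\<^sub>R v) :: ennreal)" for v t
  have hm [measurable]: "(\<lambda>(v, t). h v t) \<in> borel_measurable (lborel \<Otimes>\<^sub>M lborel)"
    unfolding h_def by measurable
  have zero: "(\<integral>\<^sup>+t. h v t \<partial>lborel) = 0" for v
  proof -
    have "(\<integral>\<^sup>+t. h v t \<partial>lborel) = (\<integral>\<^sup>+t. indicator {t. P (x0 + t *\<^sub>R v) = 0} t \<partial>lborel)"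
      by (intro nn_integral_cong) (auto simp: h_def split: split_indicator)
    also have "\<dots> = emeasure lborel {t. P (x0 + t *\<^sub>R v) = 0}"
      by (rule nn_integral_indicator) measurable
    also have "\<dots> = 0" by (rule emeasure_lborel_countable[OF cnt])
    finally show ?thesis .
  qed
  have "(\<integral>\<^sup>+t. (\<integral>\<^sup>+v. h v t \<partial>lborel) \<partial>lborel) = (\<integral>\<^sup>+v. (\<integral>\<^sup>+t. h v t \<partial>lborel) \<partial>lborel)"
    using lborel_pair.Fubini'[of "\<lambda>v t. h v t"] by simp
  also have "\<dots> = 0" by (simp add: zero)
  finally have "(\<integral>\<^sup>+t. (\<integral>\<^sup>+v. h v t \<partial>lborel) \<partial>lborel) = 0" .
  then have "AE t in lborel. (\<integral>\<^sup>+v. h v t \<partial>lborel) = 0"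
    by (subst (asm) nn_integral_0_iff_AE) auto
  \<comment> \<open>At \<open>t = 0\<close> the inner integral vanishes trivially, since
    \<open>P x0 \<noteq> 0\<close>. A nonzero \<open>t\<close> is required to transport the null set
    back by the affine map.\<close>
  then have "AE t in lborel. t \<noteq> 0 \<and> (\<integral>\<^sup>+v. h v t \<partial>lborel) = 0"
    using AE_lborel_singleton[of "0::real"] by eventually_elim simp
  moreover have "ae_filter (lborel :: real measure) \<noteq> bot"
    by (simp add: ae_filter_eq_bot_iff)
  ultimately obtain t where t: "t \<noteq> 0" "(\<integral>\<^sup>+v. h v t \<partial>lborel) = 0"
    using eventually_happens' by blast
  have "(\<integral>\<^sup>+v. h v t \<partial>lborel) = (\<integral>\<^sup>+v. indicator {v. x0 + t *\<^sub>R v \<in> {x. P x = 0}} v \<partial>lborel)"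
    by (intro nn_integral_cong) (auto simp: h_def split: split_indicator)
  also have "\<dots> = emeasure lborel {v. x0 + t *\<^sub>R v \<in> {x. P x = 0}}"
    by (rule nn_integral_indicator) measurable
  finally have "emeasure lborel {v. x0 + t *\<^sub>R v \<in> {x. P x = 0}} = 0" using t by simp
  then have "emeasure lborel {x. P x = 0} = 0"
    by (subst emeasure_lborel_affine[OF _ t(1), of _ x0]) auto
  then show ?thesis by (intro AE_I[of _ _ "{x. P x = 0}"]) auto
qed

section \<open>Counting integer translates that fall into a set\<close>

text \<open>The inner integral counts the integer translates of \<open>x\<close> in
  \<open>A\<close>. Translating by \<open>m\<close> turns the term for \<open>m\<close> into the
  measure of the part of \<open>A\<close> in the cube shifted by \<open>m\<close>, and these parts
  are disjoint.\<close>

lemma nn_integral_unit_cube_translates_le: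
  fixes A :: "(real^'n) set"
  assumes A [measurable]: "A \<in> sets borel"
  shows "(\<integral>\<^sup>+x. indicator (unit_cube a) x * (\<integral>\<^sup>+m. indicator A (x + int_vec m) \<partial>count_space UNIV) \<partial>lborel)
    \<le> emeasure lborel A"
proof -
  define B where "B m = {x. x - int_vec m \<in> unit_cube a \<and> x \<in> A}" for m
  have [measurable]: "B m \<in> sets borel" for m unfolding B_def by measurable
  have "(\<integral>\<^sup>+x. indicator (unit_cube a) x * (\<integral>\<^sup>+m. indicator A (x + int_vec m) \<partial>count_space UNIV) \<partial>lborel)
      = (\<integral>\<^sup>+x. (\<integral>\<^sup>+m. indicator (unit_cube a) x * indicator A (x + int_vec m) \<partial>count_space UNIV) \<partial>lborel)"
    by (simp add: nn_integral_cmult)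
  also have "\<dots> = (\<integral>\<^sup>+m. (\<integral>\<^sup>+x. indicator (unit_cube a) x * indicator A (x + int_vec m) \<partial>lborel) \<partial>count_space UNIV)"
    by (rule nn_integral_count_space_nn_integral) auto
  also have "\<dots> = (\<integral>\<^sup>+m. emeasure lborel (B m) \<partial>count_space UNIV)"
  proof (rule nn_integral_cong)
    fix m :: "int^'n"
    have "(\<integral>\<^sup>+x. indicator (unit_cube a) x * indicator A (x + int_vec m) \<partial>lborel)
        = (\<integral>\<^sup>+x. indicator {x. int_vec m + 1 *\<^sub>R x \<in> B m} x \<partial>lborel)"
      by (intro nn_integral_cong) (auto simp: B_def add.commute split: split_indicator)
    also have "\<dots> = emeasure lborel {x. int_vec m + 1 *\<^sub>R x \<in> B m}"
      by (rule nn_integral_indicator) measurable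
    also have "\<dots> = emeasure lborel (B m)"
      using emeasure_lborel_affine[of "B m" 1 "int_vec m"] by simp
    finally show "(\<integral>\<^sup>+x. indicator (unit_cube a) x * indicator A (x + int_vec m) \<partial>lborel) = emeasure lborel (B m)" .
  qed
  also have "\<dots> = emeasure lborel (\<Union>m. B m)"
  proof (rule emeasure_UN_countable[symmetric])
    show "disjoint_family B"
      unfolding disjoint_family_on_def
    proof (intro ballI impI, rule ccontr)
      fix m k :: "int^'n" assume "m \<noteq> k" "B m \<inter> B k \<noteq> {}"
      then obtain x i where "x \<in> B m" "x \<in> B k" and i: "m $ i \<noteq> k $ i" by (auto simp: vec_eq_iff)
      then have "a $ i \<le> x $ i - m $ i" "x $ i - m $ i < a $ i + 1"
        "a $ i \<le> x $ i - k $ i" "x $ i - k $ i < a $ i + 1"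
        by (auto simp: B_def unit_cube_def int_vec_def)
      then show False using i by linarith
    qed
  qed auto
  also have "\<dots> \<le> emeasure lborel A"
    by (rule emeasure_mono) (auto simp: B_def)
  finally show ?thesis .
qed

text \<open>Over each unit cube the number of translates in \<open>A\<close> has a finite integral
  and so is finite almost everywhere; countably many cubes cover the space.\<close>

lemma AE_finite_int_translates:
  fixes A :: "(real^'n) set"
  assumes A [measurable]: "A \<in> sets borel" and fin: "emeasure lborel A < \<infinity>"
  shows "AE x in lborel. finite {m. x + int_vec m \<in> A}"
proof -
  have "AE x in lborel. x \<in> unit_cube (int_vec k) \<longrightarrow> finite {m. x + int_vec m \<in> A}" for k
  proof -
    let ?f = "\<lambda>x. indicator (unit_cube (int_vec k)) x * (\<integral>\<^sup>+m. indicator A (x + int_vec m) \<partial>count_space UNIV)"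
    have [measurable]: "(\<lambda>x. \<integral>\<^sup>+m. indicator A (x + int_vec m) \<partial>count_space UNIV) \<in> borel_measurable lborel"
    proof -
      interpret sigma_finite_measure "count_space (UNIV :: (int^'n) set)"
        by (rule sigma_finite_measure_count_space)
      show ?thesis
      proof (rule borel_measurable_nn_integral)
        have "(\<lambda>(m, x). indicator A (x + int_vec m) :: ennreal)
          \<in> borel_measurable (count_space UNIV \<Otimes>\<^sub>M lborel)"
          by (rule measurable_pair_measure_countable1) auto
        from measurable_pair_swap[OF this]
        show "(\<lambda>(x, m). indicator A (x + int_vec m) :: ennreal)
          \<in> borel_measurable (lborel \<Otimes>\<^sub>M count_space UNIV)" by simp
      qed
    qed
    have "AE x in lborel. ?f x \<noteq> \<infinity>"
      using nn_integral_unit_cube_translates_le[OF A, of "int_vec k"] fin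
      by (intro nn_integral_noteq_infinite) auto
    then show ?thesis
    proof eventually_elim
      case (elim x)
      have "(\<integral>\<^sup>+m. indicator A (x + int_vec m) \<partial>count_space UNIV)
          = (\<integral>\<^sup>+m. indicator {m. x + int_vec m \<in> A} m \<partial>count_space UNIV)"
        by (intro nn_integral_cong) (auto split: split_indicator)
      also have "\<dots> = emeasure (count_space UNIV) {m. x + int_vec m \<in> A}"
        by (rule nn_integral_indicator) simp
      finally show ?case using elim by (auto simp: emeasure_count_space split: if_splits)
    qed
  qed
  then have "AE x in lborel. \<forall>k. x \<in> unit_cube (int_vec k) \<longrightarrow> finite {m. x + int_vec m \<in> A}"
    unfolding AE_all_countable by blast
  then show ?thesis
  proof eventually_elim
    case (elim x)
    have "x \<in> unit_cube (int_vec (\<chi> i. \<lfloor>x $ i\<rfloor>))"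
      by (simp add: unit_cube_def int_vec_def)
    then show ?case using elim by blast
  qed
qed

text \<open>Otherwise almost every point of the cube would have a translate in \<open>A\<close>, and
  the integral of the count over a cube of volume 1 would be at least 1.\<close>

lemma emeasure_missed_unit_cube_pos:
  fixes A :: "(real^'n) set"
  assumes A [measurable]: "A \<in> sets borel" and small: "emeasure lborel A < 1"
  shows "emeasure lborel {x \<in> unit_cube 0. \<forall>m. x + int_vec m \<notin> A} > 0"
proof (rule ccontr)
  let ?G = "{x \<in> unit_cube 0. \<forall>m. x + int_vec m \<notin> A}"
  have G [measurable]: "?G \<in> sets borel" by measurable
  assume "\<not> emeasure lborel ?G > 0"
  then have "emeasure lborel ?G = 0" by simp
  then have G0: "AE x in lborel. x \<notin> ?G" using G by (intro AE_I[of _ _ ?G]) auto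
  have "1 = (\<integral>\<^sup>+x. indicator (unit_cube (0::real^'n)) x \<partial>lborel)"
    by (simp add: emeasure_unit_cube)
  also have "\<dots> \<le> (\<integral>\<^sup>+x. indicator (unit_cube 0) x * (\<integral>\<^sup>+m. indicator A (x + int_vec m) \<partial>count_space UNIV) \<partial>lborel)"
  proof (rule nn_integral_mono_AE)
    show "AE x in lborel. indicator (unit_cube 0) x
       \<le> indicator (unit_cube 0) x * (\<integral>\<^sup>+m. indicator A (x + int_vec m) \<partial>count_space UNIV)"
      using G0
    proof eventually_elim
      case (elim x)
      show ?case
      proof (cases "x \<in> unit_cube 0")
        case True
        then obtain m where m: "x + int_vec m \<in> A" using elim by auto
        have "(1::ennreal) = (\<integral>\<^sup>+k. indicator {m} k \<partial>count_space UNIV)"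
          by (subst nn_integral_indicator) auto
        also have "\<dots> \<le> (\<integral>\<^sup>+k. indicator A (x + int_vec k) \<partial>count_space UNIV)"
          by (rule nn_integral_mono) (use m in \<open>auto split: split_indicator\<close>)
        finally show ?thesis using True by simp
      qed simp
    qed
  qed
  also have "\<dots> \<le> emeasure lborel A" by (rule nn_integral_unit_cube_translates_le[OF A])
  finally show False using small by simp
qed

section \<open>Benedicks' theorem\<close>

text \<open>A Borel left inverse of \<open>torus_map\<close> on \<open>unit_cube 0\<close>;
  preimages under it turn Borel subsets of the cube into Borel subsets of the ambient space of the
  torus.\<close>

definition torus_inv :: "complex^'n \<Rightarrow> real^'n" where
  "torus_inv z = (\<chi> i. Arg2pi (z $ i) / (2 * pi))"

text \<open>\<open>Arg2pi\<close> jumps across the positive real axis, but its strict superlevel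
  sets are open.\<close>

lemma borel_measurable_torus_inv [measurable]: "torus_inv \<in> borel_measurable borel"
proof -
  have [measurable]: "Arg2pi \<in> borel_measurable borel"
    by (rule borel_measurableI_greater) (simp add: open_Arg2pi2pi_gt)
  have [measurable]: "(\<lambda>z::complex^'n. z $ i) \<in> borel_measurable borel" for i
    by (intro borel_measurable_continuous_onI continuous_intros)
  have "(\<lambda>z::complex^'n. Arg2pi (z $ i) / (2 * pi)) \<in> borel_measurable borel" for i
    by measurable
  then show ?thesis
    unfolding borel_measurable_euclidean_space[of torus_inv] torus_inv_def Basis_vec_def
    by (auto simp: inner_axis)
qed

lemma torus_inv_torus_map: "torus_inv (torus_map x) = (\<chi> i. frac (x $ i))"
proof -
  have "Arg2pi (cis (2 * pi * t)) = 2 * pi * frac t" for t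
  proof (rule Arg2pi_unique)
    have "cis (2 * pi * t) = cis (2 * pi * frac t + 2 * pi * of_int \<lfloor>t\<rfloor>)"
      by (simp add: frac_def algebra_simps)
    also have "\<dots> = cis (2 * pi * frac t)"
      by (simp add: cis_mult[symmetric] cis_multiple_2pi)
    finally show "of_real 1 * exp (\<i> * of_real (2 * pi * frac t)) = cis (2 * pi * t)"
      by (simp add: cis_conv_exp)
  qed (use frac_lt_1[of t] in auto)
  then show ?thesis by (simp add: torus_inv_def torus_map_def vec_eq_iff)
qed

lemma torus_inv_torus_map_unit_cube: "x \<in> unit_cube 0 \<Longrightarrow> torus_inv (torus_map x) = x"
  unfolding torus_inv_torus_map by (simp add: unit_cube_def vec_eq_iff frac_eq)

lemma continuous_on_fourier_integral:
  fixes X :: "'a \<Rightarrow> real^'n"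
  assumes X [measurable]: "X \<in> borel_measurable M" and w: "integrable M w"
  shows "continuous_on UNIV (\<lambda>y. LINT s|M. character (- y) (X s) * w s)"
  unfolding continuous_on_sequentially
proof (intro ballI allI impI)
  fix u and a :: "real^'n" assume "(\<forall>n. u n \<in> UNIV) \<and> u \<longlonglongrightarrow> a"
  then have u: "u \<longlonglongrightarrow> a" by blast
  have [measurable]: "w \<in> borel_measurable M" using w by simp
  show "((\<lambda>y. LINT s|M. character (- y) (X s) * w s) \<circ> u) \<longlonglongrightarrow> (LINT s|M. character (- a) (X s) * w s)"
    unfolding comp_def
  proof (rule integral_dominated_convergence[where w="\<lambda>s. norm (w s)"])
    show "AE s in M. (\<lambda>n. character (- u n) (X s) * w s) \<longlonglongrightarrow> character (- a) (X s) * w s"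
    proof (rule AE_I2)
      fix s
      have "continuous_on UNIV (\<lambda>y. character (- y) (X s))" by (intro continuous_intros)
      then have "isCont (\<lambda>y. character (- y) (X s)) a" by (simp add: continuous_on_eq_continuous_at)
      from isCont_tendsto_compose[OF this u]
      show "(\<lambda>n. character (- u n) (X s) * w s) \<longlonglongrightarrow> character (- a) (X s) * w s"
        by (intro tendsto_mult_right)
    qed
  qed (use w in \<open>auto simp: norm_mult\<close>)
qed

text \<open>The map \<open>X\<close> is kept general so that a dilation of the space can be absorbed
  into it, leaving \<open>M\<close> and \<open>w\<close> untouched.\<close>

lemma benedicks_small_support:
  fixes X :: "'a \<Rightarrow> real^'n"
  assumes X [measurable]: "X \<in> borel_measurable M" and w: "integrable M w"
    and F [measurable]: "F \<in> sets borel" and E [measurable]: "E \<in> sets borel"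
    and supp: "AE s in M. X s \<in> F"
    and F1: "emeasure lborel F < 1" and Efin: "emeasure lborel E < \<infinity>"
    and zero: "\<And>y. y \<notin> E \<Longrightarrow> (LINT s|M. character (- y) (X s) * w s) = 0"
  shows "(LINT s|M. character (- y) (X s) * w s) = 0"
proof -
  define h where "h y = (LINT s|M. character (- y) (X s) * w s)" for y
  have [measurable]: "w \<in> borel_measurable M" using w by simp
  \<comment> \<open>The points of the cube that are not images of points of \<open>F\<close> under
    folding.\<close>
  define G where "G = {x \<in> unit_cube 0. \<forall>m. x + int_vec m \<notin> F}"
  have G [measurable]: "G \<in> sets borel" unfolding G_def by measurable
  have "AE y in lborel. h y = 0"
    using AE_finite_int_translates[OF E Efin]
  proof eventually_elim
    case (elim y)
    define S where "S = {m. y + int_vec m \<in> E}"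
    have fin: "finite S" using elim by (simp add: S_def)
    have hS: "h (y + int_vec m) = 0" if "m \<notin> S" for m
      using that zero[of "y + int_vec m"] unfolding S_def h_def by blast
    \<comment> \<open>The candidate for the folded measure, built from the finitely many
      coefficients that can be nonzero. Integration against \<open>character (int_vec m)\<close>
      selects the term of index \<open>- m\<close>, matching the sign in \<open>h\<close>.\<close>
    define P where "P x = (\<Sum>m\<in>S. h (y + int_vec m) * character (int_vec m) x)" for x
    have [measurable]: "P \<in> borel_measurable borel" unfolding P_def by measurable
    define u where "u s = character (- y) (X s) * w s" for s
    define v where "v x = indicator (unit_cube 0) x * P x" for x
    have u: "integrable M u" unfolding u_def by (rule bounded_integrable_mult[OF _ w, of _ 1]) auto
    have ic: "integrable lborel (\<lambda>x. indicator (unit_cube 0) x * character k x)" for k :: "real^'n"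
    proof (rule Bochner_Integration.integrable_bound)
      show "integrable lborel (indicator (unit_cube (0::real^'n)) :: _ \<Rightarrow> real)"
        by (simp add: integrable_indicator_iff emeasure_unit_cube)
    qed (auto simp: norm_mult split: split_indicator)
    have v_sum: "v x = (\<Sum>m\<in>S. h (y + int_vec m) * (indicator (unit_cube 0) x * character (int_vec m) x))" for x
      by (simp add: v_def P_def sum_distrib_left mult_ac)
    have v: "integrable lborel v"
      unfolding v_sum[abs_def] by (intro Bochner_Integration.integrable_sum integrable_mult_right ic)
    have coeff: "(LINT s|M. character (int_vec m) (X s) * u s)
        = (LINT x|lborel. character (int_vec m) x * v x)" for m
    proof -
      have "(LINT s|M. character (int_vec m) (X s) * u s) = h (y + int_vec (- m))"
        unfolding h_def u_def
        by (simp add: int_vec_minus mult.assoc[symmetric] character_add_left[symmetric] add.commute)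
      also have "\<dots> = (\<Sum>k\<in>S. h (y + int_vec k) * (if m + k = 0 then 1 else 0))"
      proof -
        have "(\<Sum>k\<in>S. h (y + int_vec k) * (if m + k = 0 then 1 else 0))
            = (\<Sum>k\<in>S. if k = - m then h (y + int_vec (- m)) else 0)"
          by (intro sum.cong refl) (auto simp: add_eq_0_iff)
        also have "\<dots> = h (y + int_vec (- m))"
          using fin hS[of "- m"] by (simp add: sum.delta)
        finally show ?thesis by simp
      qed
      also have "\<dots> = (\<Sum>k\<in>S. h (y + int_vec k) * (LINT x|lborel. indicator (unit_cube 0) x * character (int_vec (m + k)) x))"
        unfolding integral_character_unit_cube ..
      also have "\<dots> = (LINT x|lborel. (\<Sum>k\<in>S. h (y + int_vec k) * (indicator (unit_cube 0) x * character (int_vec (m + k)) x)))"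
        by (simp add: ic)
      also have "\<dots> = (LINT x|lborel. character (int_vec m) x * v x)"
        by (intro Bochner_Integration.integral_cong refl)
          (simp add: v_sum sum_distrib_left int_vec_add character_add_left mult_ac)
      finally show ?thesis .
    qed
    \<comment> \<open>The folded measure and the density \<open>P\<close> on the cube agree as
      complex measures on the torus.\<close>
    have torus: "(LINT s|M. indicator A (torus_map (X s)) * u s)
        = (LINT x|lborel. indicator A (torus_map x) * v x)" if A: "A \<in> sets borel" for A
    proof (rule borel_unique_of_continuous[OF _ _ u v _ A])
      fix g :: "complex^'n \<Rightarrow> real" assume "continuous_on UNIV g"
      then show "(LINT s|M. of_real (g (torus_map (X s))) * u s)
          = (LINT x|lborel. of_real (g (torus_map x)) * v x)"
        using torus_continuous_unique[OF X _ u v coeff, of g] by simp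
    qed measurable
    have "AE x in lborel. indicator G x * P x = 0"
    proof (rule sigma_finite_measure.density_zero[OF sigma_finite_lborel])
      have "integrable lborel (\<lambda>x. indicator G x * v x)"
        by (rule bounded_integrable_mult[OF _ v, of _ 1]) (auto split: split_indicator)
      moreover have "(\<lambda>x. indicator G x * v x) = (\<lambda>x. indicator G x * P x)"
        by (auto simp: v_def G_def split: split_indicator)
      ultimately show "integrable lborel (\<lambda>x. indicator G x * P x)" by simp
      fix B :: "(real^'n) set" assume "B \<in> sets lborel"
      then have B [measurable]: "B \<in> sets borel" by simp
      \<comment> \<open>On the cube the pullback of \<open>?A\<close> is
        \<open>G \<inter> B\<close>, while almost every \<open>X s\<close> lies in \<open>F\<close>
        and is folded to a point outside \<open>G\<close>. So the side of \<open>M\<close> is 0, and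
        \<open>P\<close> has integral 0 over every \<open>G \<inter> B\<close>.\<close>
      let ?A = "torus_inv -` (G \<inter> B)"
      have A: "?A \<in> sets borel"
        using measurable_sets[OF borel_measurable_torus_inv, of "G \<inter> B"] by simp
      have "AE s in M. indicator ?A (torus_map (X s)) * u s = 0"
        using supp
      proof eventually_elim
        case (elim s)
        have "torus_inv (torus_map (X s)) + int_vec (\<chi> i. \<lfloor>X s $ i\<rfloor>) = X s"
          unfolding torus_inv_torus_map by (simp add: int_vec_def vec_eq_iff frac_def)
        then have "torus_inv (torus_map (X s)) \<notin> G"
          using elim unfolding G_def by (metis (mono_tags, lifting) mem_Collect_eq)
        then show ?case by simp
      qed
      then have "(LINT s|M. indicator ?A (torus_map (X s)) * u s) = 0"
        by (rule integral_eq_zero_AE)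
      then have "(LINT x|lborel. indicator ?A (torus_map x) * v x) = 0"
        using torus[OF A] by simp
      moreover have "indicator ?A (torus_map x) * v x = indicator B x *\<^sub>R (indicator G x * P x)" for x
        by (cases "x \<in> unit_cube 0")
          (auto simp: v_def torus_inv_torus_map_unit_cube G_def split: split_indicator)
      ultimately show "set_lebesgue_integral lborel B (\<lambda>x. indicator G x * P x) = 0"
        by (simp add: set_lebesgue_integral_def)
    qed
    have P0: "P x = 0" for x
    proof (rule ccontr)
      assume "P x \<noteq> 0"
      then have "AE x in lborel. P x \<noteq> 0"
        unfolding P_def by (rule trig_polynomial_zeros_null)
      with \<open>AE x in lborel. indicator G x * P x = 0\<close> have "AE x in lborel. x \<notin> G"
        by eventually_elim auto
      then have "emeasure lborel G = 0"
        by (subst (asm) AE_iff_measurable[of G]) auto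
      then show False
        using emeasure_missed_unit_cube_pos[OF F F1] by (simp add: G_def)
    qed
    \<comment> \<open>The coefficient of index 0 is \<open>h y\<close> itself, and the cube side
      integrates 0.\<close>
    show "h y = 0"
      using coeff[of 0] by (simp add: h_def u_def v_def P0)
  qed
  then have "AE y in lebesgue. y \<in> {y. h y = 0}"
    by (intro AE_completion) simp
  moreover have "closed {y. h y = 0}"
    unfolding h_def by (intro closed_Collect_eq continuous_on_fourier_integral X w continuous_on_const)
  ultimately have "y \<in> {y. h y = 0}" by (intro mem_closed_if_AE_lebesgue)
  then show ?thesis by (simp add: h_def)
qed

lemma benedicks:
  fixes M :: "(real^'n) measure"
  assumes M: "sets M = sets borel" and w: "integrable M w"
    and F [measurable]: "F \<in> sets borel" and E [measurable]: "E \<in> sets borel"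
    and supp: "AE x in M. x \<in> F"
    and Ffin: "emeasure lborel F < \<infinity>" and Efin: "emeasure lborel E < \<infinity>"
    and zero: "\<And>y. y \<notin> E \<Longrightarrow> (LINT x|M. character (- y) x * w x) = 0"
  shows "(LINT x|M. character y x * w x) = 0"
proof -
  have [measurable]: "(\<lambda>x. x) \<in> borel_measurable M" using M by (simp add: measurable_ident_sets)
  \<comment> \<open>As \<open>L \<ge> 1\<close> and the dimension is positive,
    \<open>L ^ DIM(real^'n) \<ge> L\<close>, which exceeds the measure of \<open>F\<close>.
    Shrinking \<open>F\<close> by \<open>L\<close> therefore brings its measure below 1, at the
    price of enlarging \<open>E\<close> by the same factor, which keeps it of finite
    measure.\<close>
  define L where "L = enn2real (emeasure lborel F) + 1"
  have L: "1 \<le> L" by (simp add: L_def)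
  then have L0: "L \<noteq> 0" by linarith
  note L = L L0
  have LF: "emeasure lborel F < ennreal (L ^ DIM(real^'n))"
  proof -
    have "L ^ 1 \<le> L ^ DIM(real^'n)" using L by (intro power_increasing) auto
    then have "enn2real (emeasure lborel F) < L ^ DIM(real^'n)" by (simp add: L_def)
    then show ?thesis
      using Ffin by (metis ennreal_enn2real ennreal_lessI enn2real_nonneg infinity_ennreal_def less_le_trans not_less order_le_less)
  qed
  \<comment> \<open>At the frequency \<open>- L *\<^sub>R y\<close> both the factor
    \<open>1 / L\<close> and the sign cancel, which leaves \<open>character y x\<close>.\<close>
  have "(LINT x|M. character (- (- L *\<^sub>R y)) ((1 / L) *\<^sub>R x) * w x) = 0"
  proof (rule benedicks_small_support[where F="{x. 0 + L *\<^sub>R x \<in> F}" and E="{y. (1 / L) *\<^sub>R y \<in> E}"])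
    show "AE x in M. (1 / L) *\<^sub>R x \<in> {x. 0 + L *\<^sub>R x \<in> F}"
      using supp L by simp
    show "emeasure lborel {x. 0 + L *\<^sub>R x \<in> F} < 1"
    proof (rule ccontr)
      assume "\<not> emeasure lborel {x. 0 + L *\<^sub>R x \<in> F} < 1"
      then have "ennreal (L ^ DIM(real^'n)) * 1 \<le> ennreal (\<bar>L\<bar> ^ DIM(real^'n)) * emeasure lborel {x. 0 + L *\<^sub>R x \<in> F}"
        using L by (intro mult_mono) auto
      also have "\<dots> = emeasure lborel F" by (rule emeasure_lborel_affine[OF F L(2), symmetric])
      finally show False using LF by simp
    qed
    have "emeasure lborel {y. (1 / L) *\<^sub>R y \<in> E} = ennreal (\<bar>L\<bar> ^ DIM(real^'n)) * emeasure lborel {y. 0 + L *\<^sub>R y \<in> {y. (1 / L) *\<^sub>R y \<in> E}}"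
      by (rule emeasure_lborel_affine[OF _ L(2)]) measurable
    also have "{y. 0 + L *\<^sub>R y \<in> {y. (1 / L) *\<^sub>R y \<in> E}} = E" using L by auto
    finally show "emeasure lborel {y. (1 / L) *\<^sub>R y \<in> E} < \<infinity>"
      using Efin by (simp add: ennreal_mult_less_top)
    fix y assume "y \<notin> {y. (1 / L) *\<^sub>R y \<in> E}"
    then show "(LINT x|M. character (- y) ((1 / L) *\<^sub>R x) * w x) = 0"
      using zero[of "(1 / L) *\<^sub>R y"] by (simp add: character_def)
  qed (use w in measurable)
  then show ?thesis using L by (simp add: character_def)
qed

text \<open>The functions \<open>L sin (2 \<pi> x\<^sub>i / L) / (2 \<pi>)\<close> factor through the torus of side \<open>L\<close> and tend to the
  coordinates as \<open>L\<close> grows, which transfers uniqueness from the torus to the whole space.\<close>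

lemma fourier_integral_unique:
  fixes M :: "(real^'n) measure"
  assumes M: "sets M = sets borel" and w: "integrable M w"
    and zero: "\<And>y. (LINT x|M. character y x * w x) = 0"
    and A: "A \<in> sets borel"
  shows "(LINT x|M. indicator A x * w x) = 0"
proof -
  have id [measurable]: "(\<lambda>x. x) \<in> borel_measurable M" using M by (simp add: measurable_ident_sets)
  have [measurable]: "w \<in> borel_measurable M" using w by simp
  \<comment> \<open>The derivative of the sine at 0; \<open>Suc k\<close>, the side of the torus,
    avoids division by 0.\<close>
  have sin_lim: "(\<lambda>k. real (Suc k) / (2 * pi) * sin (2 * pi * (t / real (Suc k)))) \<longlonglongrightarrow> t" for t
  proof -
    have "((\<lambda>h. sin (2 * pi * (t * h)) / (2 * pi)) has_field_derivative t) (at 0)"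
      by (auto intro!: derivative_eq_intros)
    then have "(\<lambda>h. sin (2 * pi * (t * h)) / (2 * pi) / h) \<midarrow>0\<rightarrow> t"
      by (simp add: DERIV_def)
    moreover have "filterlim (\<lambda>k. inverse (real (Suc k))) (at 0) sequentially"
      by (auto simp: filterlim_at LIMSEQ_inverse_real_of_nat simp del: of_nat_Suc)
    ultimately have "(\<lambda>k. sin (2 * pi * (t * inverse (real (Suc k)))) / (2 * pi) / inverse (real (Suc k))) \<longlonglongrightarrow> t"
      by (rule filterlim_compose)
    then show ?thesis by (simp add: field_simps)
  qed
  \<comment> \<open>Vanishing is obtained as equality with the zero weight over the same
    measure.\<close>
  have "(LINT x|M. indicator A x * w x) = (LINT x|M. indicator A x * 0)"
  proof (rule borel_unique_of_continuous[OF id id w _ _ A])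
    fix g :: "real^'n \<Rightarrow> real"
    assume g: "continuous_on UNIV g" and g01: "\<And>z. 0 \<le> g z \<and> g z \<le> 1"
    have gm [measurable]: "g \<in> borel_measurable borel" by (rule borel_measurable_continuous_onI[OF g])
    \<comment> \<open>Applied to \<open>torus_map (?X k x)\<close>, this reads off the scaled sines,
      so \<open>g\<close> composed with it is a continuous function on the torus even though
      \<open>g\<close> is not periodic.\<close>
    define p where "p k z = (\<chi> i. real (Suc k) / (2 * pi) * Im (z $ i))" for k and z :: "complex^'n"
    have p: "continuous_on UNIV (p k)" for k unfolding p_def by (intro continuous_intros)
    have pm [measurable]: "p k \<in> borel_measurable borel" for k by (rule borel_measurable_continuous_onI[OF p])
    let ?X = "\<lambda>k x::real^'n. (1 / real (Suc k)) *\<^sub>R x"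
    have z: "(LINT x|M. of_real (g (p k (torus_map (?X k x)))) * w x) = 0" for k
    proof -
      have "(LINT x|M. of_real (g (p k (torus_map (?X k x)))) * w x)
          = (LINT x|M. of_real (g (p k (torus_map (?X k x)))) * 0)"
      proof (rule torus_continuous_unique[where g="\<lambda>z. g (p k z)"])
        show "continuous_on UNIV (\<lambda>z. g (p k z))"
          using continuous_on_compose2[OF g p] by simp
        fix m
        \<comment> \<open>A Fourier coefficient on the torus of side \<open>Suc k\<close> is the
          Fourier integral at a frequency in the lattice scaled by \<open>1 / Suc k\<close>.\<close>
        have "(LINT x|M. character (int_vec m) (?X k x) * w x) = (LINT x|M. character ((1 / real (Suc k)) *\<^sub>R int_vec m) x * w x)"
          by (simp add: character_def)
        then show "(LINT x|M. character (int_vec m) (?X k x) * w x) = (LINT x|M. character (int_vec m) (?X k x) * 0)"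
          using zero by simp
      qed (use w in \<open>auto\<close>)
      then show ?thesis by simp
    qed
    have "(\<lambda>k. LINT x|M. of_real (g (p k (torus_map (?X k x)))) * w x) \<longlonglongrightarrow> (LINT x|M. of_real (g x) * w x)"
    proof (rule integral_dominated_convergence[where w="\<lambda>x. norm (w x)"])
      show "AE x in M. (\<lambda>k. of_real (g (p k (torus_map (?X k x)))) * w x) \<longlonglongrightarrow> of_real (g x) * w x"
      proof (rule AE_I2)
        fix x :: "real^'n"
        have "(\<lambda>k. p k (torus_map (?X k x))) \<longlonglongrightarrow> x"
          by (rule vec_tendstoI) (use sin_lim in \<open>simp add: p_def torus_map_def\<close>)
        moreover have "isCont g x" using g by (simp add: continuous_on_eq_continuous_at)
        ultimately have "(\<lambda>k. g (p k (torus_map (?X k x)))) \<longlonglongrightarrow> g x"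
          by (rule isCont_tendsto_compose[rotated])
        then show "(\<lambda>k. of_real (g (p k (torus_map (?X k x)))) * w x) \<longlonglongrightarrow> of_real (g x) * w x"
          by (intro tendsto_mult_right tendsto_of_real)
      qed
      show "AE x in M. norm (of_real (g (p k (torus_map (?X k x)))) * w x) \<le> norm (w x)" for k
        using g01 by (intro AE_I2) (auto simp: norm_mult intro!: mult_left_le_one_le)
    qed (use w in \<open>measurable, auto\<close>)
    then have "(LINT x|M. of_real (g x) * w x) = 0"
      unfolding z by (simp add: LIMSEQ_const_iff)
    then show "(LINT x|M. of_real (g x) * w x) = (LINT x|M. of_real (g x) * 0)" by simp
  qed simp
  then show ?thesis by simp
qed

section \<open>From Lebesgue measurable sets and partial set functions to the theorem\<close>

text \<open>Both support conditions survive enlarging the set, so Lebesgue measurable supports may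
  be replaced by Borel ones of finite measure.\<close>

lemma lmeasurable_borel_superset:
  fixes S :: "'a::euclidean_space set"
  assumes "S \<in> lmeasurable"
  obtains T where "T \<in> sets borel" "S \<subseteq> T" "emeasure lborel T < \<infinity>"
proof -
  from assms have "S \<in> sets lebesgue" by (rule fmeasurableD)
  then obtain T where T: "open T" "S \<subseteq> T" "T - S \<in> lmeasurable"
    using sets_lebesgue_outer_open[of S 1] by auto
  have "S \<union> (T - S) \<in> lmeasurable" by (rule fmeasurable.Un[OF assms T(3)])
  also have "S \<union> (T - S) = T" using T(2) by blast
  finally have "emeasure lborel T < \<infinity>"
    using T(1) by (auto simp: fmeasurable_def)
  with T show thesis by (intro that) auto
qed

theorem theorem9:
  fixes \<mu> :: "(real^'n) set \<rightharpoonup> complex"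
  assumes "\<mu> \<in> M2" and "finite_cm \<mu>" and "\<not> zero_cm \<mu>"
  shows "\<not> (\<exists>E F :: (real^'n) set. E \<in> lmeasurable \<and> F \<in> lmeasurable \<and>
           supported_cm \<mu> F \<and> (\<forall>y. y \<notin> E \<longrightarrow> fourier_cm \<mu> y = 0))"
proof
  have \<mu>: "\<mu> \<in> sigma_finite_complex_measures" using assms(1) by (simp add: M2_def)
  assume "\<exists>E F :: (real^'n) set. E \<in> lmeasurable \<and> F \<in> lmeasurable \<and>
           supported_cm \<mu> F \<and> (\<forall>y. y \<notin> E \<longrightarrow> fourier_cm \<mu> y = 0)"
  then obtain E0 F0 :: "(real^'n) set" where "E0 \<in> lmeasurable" "F0 \<in> lmeasurable"
    and supp: "supported_cm \<mu> F0" and zero: "\<And>y. y \<notin> E0 \<Longrightarrow> fourier_cm \<mu> y = 0" by blast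
  then obtain E F where E: "E \<in> sets borel" "E0 \<subseteq> E" "emeasure lborel E < \<infinity>"
    and F: "F \<in> sets borel" "F0 \<subseteq> F" "emeasure lborel F < \<infinity>"
    by (metis lmeasurable_borel_superset)
  obtain M w where M: "sets M = sets borel" "integrable M w"
    and int: "\<And>h B. h \<in> borel_measurable borel \<Longrightarrow> (\<And>x. norm (h x) \<le> B) \<Longrightarrow>
       integral_cm \<mu> h = (LINT x|M. h x * w x)"
    and meas: "\<And>A. A \<in> sets borel \<Longrightarrow> the (\<mu> A) = (LINT x|M. indicator A x * w x)"
    and sup: "\<And>F. supported_cm \<mu> F \<Longrightarrow> F \<in> sets borel \<Longrightarrow> AE x in M. x \<in> F"
    using finite_cm_density[OF \<mu> assms(2)] by blast
  have "supported_cm \<mu> F" using supp F(2) unfolding supported_cm_def by blast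
  then have supp': "AE x in M. x \<in> F" using F(1) by (rule sup)
  have "fourier_cm \<mu> y = (LINT x|M. character (- y) x * w x)" for y
  proof -
    have "fourier_cm \<mu> y = integral_cm \<mu> (character (- y))"
      unfolding fourier_cm_def
      by (rule arg_cong[where f="integral_cm \<mu>"]) (simp add: fun_eq_iff character_def cis_conv_exp inner_commute mult_ac)
    also have "\<dots> = (LINT x|M. character (- y) x * w x)"
      by (rule int[of _ 1]) auto
    finally show ?thesis .
  qed
  then have "(LINT x|M. character (- y) x * w x) = 0" if "y \<notin> E" for y
    using zero[of y] that E(2) by auto
  then have "(LINT x|M. character y x * w x) = 0" for y
    by (rule benedicks[OF M F(1) E(1) supp' F(3) E(3)])
  then have "the (\<mu> A) = 0" if "A \<in> sets borel" for A
    using fourier_integral_unique[OF M _ that] meas[OF that] by simp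
  \<comment> \<open>\<open>the\<close> is informative only on the domain, and \<open>zero_cm\<close>
    asks for the value \<open>Some 0\<close>; finiteness puts every Borel set into the
    domain.\<close>
  moreover have "\<exists>c. \<mu> A = Some c" if "A \<in> sets borel" for A
    using that finite_cm_dom[OF \<mu> assms(2)] by blast
  ultimately have "zero_cm \<mu>" unfolding zero_cm_def by force
  with assms(3) show False by contradiction
qed

end
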